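(* Let $k\ge 3$ and let $1\le a_1\le a_2\le\cdots\le a_k$ be integers with $a_2\ge 2$. Let $\Theta=\Theta(a_1,\ldots,a_k)$ be the generalized theta graph with hubs $u,v$, and let $r$ be an integer with $3\le r\le (a_1+a_2+1)/2$. Let $\mathcal{P}^r=\mathcal{P}^r(\Theta)$ be the family of all paths on exactly $r$ vertices in $\Theta$. Then $\Theta$ is strictly $\mathcal{P}^r$-EKR. In particular, if $\mathcal{F}\subseteq\mathcal{P}^r(\Theta)$ is an intersecting family, then $|\mathcal{F}|\le f_k(r)$, where \[ f_k(r)=\begin{cases} k+\binom{k}{2}(r-2) & \text{when } 3\le r\le a_1+1,\\ (r-a_1-2)(k-1)^2+(a_1+2)(k-1)+(r-2)\binom{k-1}{2} & \text{when } a_1+2\le r\le a_2-1, \end{cases} \] with equality if and only if $\mathcal{F}$ is a full star centered on one of the hubs of $\Theta$, i.e. $\mathcal{F}=\mathcal{P}^r_u$ or $\mathcal{F}=\mathcal{P}^r_v$.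
   Context: The generalized theta graph $\Theta(a_1,\ldots,a_k)$ is the union of $k$ pairwise internally vertex-disjoint $u,v$-paths (strands) $P_{(i)}=w_{i,0}w_{i,1}\cdots w_{i,a_i}$, $1\le i\le k$, with $w_{i,0}=u$ and $w_{i,a_i}=v$ (so $P_{(i)}$ has $a_i$ edges). The vertices $u$ and $v$ are the hubs. A path is a subgraph; intersections of paths are taken as intersections of their vertex sets. A family of paths is intersecting if any two of its members share a vertex, and it is a star if all its members share a common vertex. For a family $\mathcal{F}$ of paths and a vertex $x$, $\mathcal{F}_x=\{A\in\mathcal{F}\mid x\in V(A)\}$ is the full star at $x$. A graph $G$ is $\mathcal{F}$-EKR, where $\mathcal{F}$ is a family of paths of $G$, if there is a vertex $x$ with $|\mathcal{F}_x|\ge|\mathcal{H}|$ for every intersecting $\mathcal{H}\subseteq\mathcal{F}$; it is strictly so if moreover every intersecting subfamily of $\mathcal{F}$ of maximum size is a star. (For $3\le r\le (a_1+a_2+1)/2$, one of the two cases in the definition of $f_k(r)$ always applies.) *)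

theory Defs
  imports Complex_Main
begin

text \<open>
  A graph is a pair of a vertex set and an edge set, edges being two-element sets of vertices.
  Paths are subgraphs (not vertex sequences), so a path and its reversal are the same path.
\<close>

type_synonym 'a graph = "'a set \<times> 'a set set"

abbreviation verts :: "'a graph \<Rightarrow> 'a set" where
  "verts G \<equiv> fst G"

abbreviation edges :: "'a graph \<Rightarrow> 'a set set" where
  "edges G \<equiv> snd G"

definition subgraph :: "'a graph \<Rightarrow> 'a graph \<Rightarrow> bool" where
  "subgraph H G \<longleftrightarrow> verts H \<subseteq> verts G \<and> edges H \<subseteq> edges G"

definition walk_graph :: "'a list \<Rightarrow> 'a graph" where
  "walk_graph xs = (set xs, {{xs ! i, xs ! Suc i} | i. Suc i < length xs})"

definition is_path :: "'a graph \<Rightarrow> bool" where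
  "is_path P \<longleftrightarrow> (\<exists>xs. xs \<noteq> [] \<and> distinct xs \<and> P = walk_graph xs)"

definition paths_on :: "nat \<Rightarrow> 'a graph \<Rightarrow> 'a graph set" where
  "paths_on r G = {P. is_path P \<and> subgraph P G \<and> card (verts P) = r}"

definition strand :: "(nat \<Rightarrow> nat) \<Rightarrow> (nat \<Rightarrow> nat \<Rightarrow> 'a) \<Rightarrow> nat \<Rightarrow> 'a graph" where
  "strand a w i = walk_graph (map (w i) [0..<Suc (a i)])"

text \<open>
  Strands are indexed by \<open>1, \<dots>, k\<close>; the values of \<open>a\<close> elsewhere are irrelevant. The predicate holds
  for every graph that is a union of strands as required, on any vertex type. It is meant for
  positive lengths at most one of which is 1; otherwise strands of length 1 would share their edge.
\<close>

definition generalized_theta ::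
    "nat \<Rightarrow> (nat \<Rightarrow> nat) \<Rightarrow> 'a \<Rightarrow> 'a \<Rightarrow> 'a graph \<Rightarrow> bool" where
  "generalized_theta k a u v G \<longleftrightarrow>
    (\<exists>w. (\<forall>i\<in>{1..k}. inj_on (w i) {0..a i} \<and> w i 0 = u \<and> w i (a i) = v) \<and>
         (\<forall>i\<in>{1..k}. \<forall>j\<in>{1..k}. i \<noteq> j \<longrightarrow>
            verts (strand a w i) \<inter> verts (strand a w j) = {u, v}) \<and>
         G = (\<Union>i\<in>{1..k}. verts (strand a w i), \<Union>i\<in>{1..k}. edges (strand a w i)))"

definition intersecting :: "'a graph set \<Rightarrow> bool" where
  "intersecting F \<longleftrightarrow> (\<forall>A\<in>F. \<forall>B\<in>F. verts A \<inter> verts B \<noteq> {})"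

definition is_star :: "'a graph set \<Rightarrow> bool" where
  "is_star F \<longleftrightarrow> (\<exists>x. \<forall>A\<in>F. x \<in> verts A)"

definition full_star :: "'a graph set \<Rightarrow> 'a \<Rightarrow> 'a graph set" where
  "full_star F x = {A \<in> F. x \<in> verts A}"

text \<open>The next two notions compare cardinalities and are meant for finite families.\<close>

definition EKR :: "'a graph \<Rightarrow> 'a graph set \<Rightarrow> bool" where
  "EKR G F \<longleftrightarrow>
    (\<exists>x\<in>verts G. \<forall>H\<subseteq>F. intersecting H \<longrightarrow> card H \<le> card (full_star F x))"

definition strictly_EKR :: "'a graph \<Rightarrow> 'a graph set \<Rightarrow> bool" where
  "strictly_EKR G F \<longleftrightarrow> EKR G F \<and>
    (\<forall>H\<subseteq>F. intersecting H \<and> (\<forall>H'\<subseteq>F. intersecting H' \<longrightarrow> card H' \<le> card H) \<longrightarrow> is_star H)"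

text \<open>
  The parameter \<open>a1\<close> is the length of a shortest strand. The second branch has \<open>r \<ge> a1 + 2\<close>, so its
  subtractions do not truncate; for \<open>r \<le> (a1 + a2 + 1) / 2\<close> it also entails \<open>r \<le> a2 - 1\<close>.
\<close>

definition theta_bound :: "nat \<Rightarrow> nat \<Rightarrow> nat \<Rightarrow> nat" where
  "theta_bound k a1 r =
    (if r \<le> a1 + 1 then k + (k choose 2) * (r - 2)
     else (r - a1 - 2) * (k - 1)^2 + (a1 + 2) * (k - 1) + (r - 2) * ((k - 1) choose 2))"

end

theory Submission
  imports Defs
begin

text \<open>
  Every cycle of the graph has at least \<open>a 1 + a 2 \<ge> 2 * r - 1\<close> vertices, and an \<open>r\<close>-path containing
  both hubs contains the first strand.

  Suppose first that every member of the family contains a hub. Reflecting the arms gives a bijection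
  between the paths that contain \<open>u\<close> only and those that contain \<open>v\<close> only which maps each path to a
  disjoint one; so an intersecting family has at most one path from each pair, and at most as many
  members as the full star at \<open>u\<close>. In case of equality exactly one path of each pair occurs, and the
  paths that end in a hub (or, when the first strand is short, also those that avoid it) force all
  choices to be made on the same side.

  Otherwise some member \<open>A\<close> lies in the interior of a strand \<open>i\<close>. Every other member separates two
  consecutive vertices of \<open>A\<close>, as in Katona's cycle method. Paths separating the same two vertices
  from different sides are disjoint, except for one possible pair, so each of the \<open>r - 1\<close> pairs of
  consecutive vertices accounts for few members, and the family is strictly smaller than the star.
\<close>

section \<open>Walks in theta graphs\<close>

text \<open>Arms of p edges from \<open>u\<close> and q edges from \<open>v\<close> on strand
  \<open>l\<close> are disjoint exactly when p + q < \<open>a l\<close>. Two arms on strands with at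
  least \<open>r\<close> edges can therefore be reflected by exchanging their lengths p and r - 1 -
  p, since the lengths met on each strand add up to r - 1. Two kinds of paths resist this exchange.
  The first are the paths ending in a hub: their one arm of r - 1 edges may be too long to face its
  mirror image on the same strand, so the strands are shifted cyclically instead. The second are the
  paths using a short first strand. There p is sent to \<open>a 1 - 1 - p\<close>, but the two
  remaining arms then have \<open>2 * r - 1 - a 1\<close> edges together, possibly as many as
  \<open>a 2\<close>, so one of them must move to a different long strand; this needs a third
  strand. The shifts also link the choices in the equality case: a path chosen at one hub blocks a
  path at the other, whose partner is then forced, and the forced choices spread over the strands.
  For interior members the hypothesis on \<open>r\<close> is just too weak to exclude cycles on
  \<open>2 * r - 1\<close> vertices; these cause the exceptional pair.\<close>

definition flip :: "(nat \<Rightarrow> nat) \<Rightarrow> (nat \<Rightarrow> nat \<Rightarrow> 'a) \<Rightarrow> nat \<Rightarrow> nat \<Rightarrow> 'a" where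
  "flip a w i n = w i (a i - n)"

definition seg_path :: "nat \<Rightarrow> (nat \<Rightarrow> nat \<Rightarrow> 'a) \<Rightarrow> nat \<Rightarrow> nat \<Rightarrow> 'a graph" where
  "seg_path r w i s = walk_graph (map (w i) [s..<s + r])"

text \<open>The hub is listed once, as \<open>w j 0\<close>, and the arm on \<open>i\<close> begins
  at position 1. With \<open>\<alpha> = 0\<close> the same list arises for every \<open>i\<close>,
  which is why index triples are normalised later.\<close>

definition hub_list :: "(nat \<Rightarrow> nat \<Rightarrow> 'a) \<Rightarrow> nat \<Rightarrow> nat \<Rightarrow> nat \<Rightarrow> nat \<Rightarrow> 'a list" where
  "hub_list w i \<alpha> j \<beta> = rev (map (w i) [1..<Suc \<alpha>]) @ map (w j) [0..<Suc \<beta>]"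

definition hub_path :: "(nat \<Rightarrow> nat \<Rightarrow> 'a) \<Rightarrow> nat \<Rightarrow> nat \<Rightarrow> nat \<Rightarrow> nat \<Rightarrow> 'a graph" where
  "hub_path w i \<alpha> j \<beta> = walk_graph (hub_list w i \<alpha> j \<beta>)"

text \<open>The arm length \<open>\<alpha>\<close> is counted from \<open>u\<close> and
  \<open>\<beta>\<close> from \<open>v\<close>. Both arms may lie on the same strand, entered from
  its two ends.\<close>

definition bridge_list ::
    "(nat \<Rightarrow> nat) \<Rightarrow> (nat \<Rightarrow> nat \<Rightarrow> 'a) \<Rightarrow> nat \<Rightarrow> nat \<Rightarrow> nat \<Rightarrow> nat \<Rightarrow> 'a list" where
  "bridge_list a w i \<alpha> j \<beta> =
     rev (map (w i) [1..<Suc \<alpha>]) @ map (w 1) [0..<Suc (a 1)] @ map (flip a w j) [1..<Suc \<beta>]"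

definition bridge_path ::
    "(nat \<Rightarrow> nat) \<Rightarrow> (nat \<Rightarrow> nat \<Rightarrow> 'a) \<Rightarrow> nat \<Rightarrow> nat \<Rightarrow> nat \<Rightarrow> nat \<Rightarrow> 'a graph" where
  "bridge_path a w i \<alpha> j \<beta> = walk_graph (bridge_list a w i \<alpha> j \<beta>)"

section \<open>Walk graphs and reversed lists\<close>

lemma verts_walk_graph [simp]: "verts (walk_graph xs) = set xs"
  by (simp add: walk_graph_def)

lemma walk_graph_rev [simp]: "walk_graph (rev xs) = walk_graph xs"
proof -
  have *: "{{rev xs ! i, rev xs ! Suc i} | i. Suc i < length xs}
    \<subseteq> {{xs ! i, xs ! Suc i} | i. Suc i < length xs}" for xs :: "'a list"
  proof safe
    fix i assume i: "Suc i < length xs"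
    have "rev xs ! i = xs ! Suc (length xs - Suc (Suc i))" "rev xs ! Suc i = xs ! (length xs - Suc (Suc i))"
      using i by (auto simp: rev_nth Suc_diff_Suc)
    then show "\<exists>j. {rev xs ! i, rev xs ! Suc i} = {xs ! j, xs ! Suc j} \<and> Suc j < length xs"
      using i by (intro exI[of _ "length xs - Suc (Suc i)"]) auto
  qed
  have "{{rev xs ! i, rev xs ! Suc i} | i. Suc i < length xs}
    = {{xs ! i, xs ! Suc i} | i. Suc i < length xs}"
    using *[of xs] *[of "rev xs"] by auto
  then show ?thesis
    by (simp add: walk_graph_def)
qed

lemma walk_graph_subgraph_iff:
  assumes "xs \<noteq> []"
  shows "subgraph (walk_graph xs) G \<longleftrightarrow>
    set xs \<subseteq> verts G \<and> successively (\<lambda>x y. {x, y} \<in> edges G) xs"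
  unfolding subgraph_def walk_graph_def successively_conv_nth by auto

lemma rev_map_flip:
  assumes "m \<le> a i"
  shows "map (flip a w i) [0..<Suc m] = rev (map (w i) [a i - m..<Suc (a i)])"
  using assms by (intro nth_equalityI) (auto simp: flip_def rev_nth simp del: upt_Suc)

lemma rev_map_flip_Suc:
  assumes "m \<le> a i"
  shows "map (flip a w i) [1..<Suc m] = rev (map (w i) [a i - m..<a i])"
  using assms by (intro nth_equalityI) (auto simp: flip_def rev_nth simp del: upt_Suc)

definition hub_of :: "nat \<Rightarrow> (nat \<Rightarrow> nat \<Rightarrow> 'a) \<Rightarrow> nat \<times> nat \<times> nat \<Rightarrow> 'a graph" where
  "hub_of r w = (\<lambda>(i, \<alpha>, j). hub_path w i \<alpha> j (r - 1 - \<alpha>))"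

definition bridge_of ::
    "(nat \<Rightarrow> nat) \<Rightarrow> nat \<Rightarrow> (nat \<Rightarrow> nat \<Rightarrow> 'a) \<Rightarrow> nat \<times> nat \<times> nat \<Rightarrow> 'a graph" where
  "bridge_of a r w = (\<lambda>(i, \<alpha>, j). bridge_path a w i \<alpha> j (r - 1 - a 1 - \<alpha>))"

section \<open>Counting facts that do not involve graphs\<close>

lemma card_ordered_pairs:
  fixes m k :: nat
  assumes "m \<le> Suc k"
  shows "finite {(i, j). m \<le> i \<and> i < j \<and> j \<le> k}"
    and "card {(i, j). m \<le> i \<and> i < j \<and> j \<le> k} = (Suc k - m) choose 2"
proof -
  have eq: "{(i, j). m \<le> i \<and> i < j \<and> j \<le> k} = prod.swap ` (SIGMA j:{m..k}. {m..<j})"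
    by (auto simp: image_iff)
  show "finite {(i, j). m \<le> i \<and> i < j \<and> j \<le> k}"
    unfolding eq by (intro finite_imageI finite_SigmaI) auto
  have "card {(i, j). m \<le> i \<and> i < j \<and> j \<le> k} = (\<Sum>j = m..k. j - m)"
    unfolding eq by (subst card_image) (auto intro: inj_onI)
  also have "\<dots> = (\<Sum>j = 0..k - m. j)"
  proof (cases "m \<le> k")
    case True
    then show ?thesis
      using sum.shift_bounds_cl_nat_ivl[of "\<lambda>j. j - m" 0 m "k - m"] by simp
  qed simp
  also have "\<dots> = (Suc k - m) choose 2"
    using assms gauss_sum_nat[of "k - m"]
    by (cases "m = Suc k") (simp_all add: choose_two Suc_diff_le algebra_simps)
  finally show "card {(i, j). m \<le> i \<and> i < j \<and> j \<le> k} = (Suc k - m) choose 2" .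
qed

lemma card_le_by_pairing:
  fixes g h :: "'i \<Rightarrow> 'b"
  assumes X: "finite X" "inj_on \<phi> X" "\<phi> ` X \<subseteq> X" and D: "finite D"
    and F: "F \<subseteq> g ` X \<union> h ` X \<union> D" and pair: "\<And>x. x \<in> X \<Longrightarrow> g x \<in> F \<Longrightarrow> h (\<phi> x) \<notin> F"
  shows "card F \<le> card X + card D"
    and "card F = card X + card D \<Longrightarrow> x \<in> X \<Longrightarrow> g x \<in> F \<or> h (\<phi> x) \<in> F"
proof -
  define A where "A = {x \<in> X. g x \<in> F}"
  define B where "B = {x \<in> X. h (\<phi> x) \<in> F}"
  have fin: "finite A" "finite B" and sub: "A \<union> B \<subseteq> X"
    using X(1) by (auto simp: A_def B_def)
  have disj: "A \<inter> B = {}"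
    using pair unfolding A_def B_def by blast
  have surj: "\<phi> ` X = X"
    using endo_inj_surj[OF X(1,3,2)] .
  have "F \<subseteq> g ` A \<union> (h \<circ> \<phi>) ` B \<union> D"
  proof
    fix y assume y: "y \<in> F"
    have "y \<in> (h \<circ> \<phi>) ` B" if "y \<in> h ` X"
    proof -
      have "y \<in> h ` \<phi> ` X"
        using that surj by simp
      then obtain x where "x \<in> X" "y = h (\<phi> x)"
        by blast
      then show ?thesis
        using y by (auto simp: B_def)
    qed
    then show "y \<in> g ` A \<union> (h \<circ> \<phi>) ` B \<union> D"
      using F y by (auto simp: A_def)
  qed
  then have "card F \<le> card (g ` A \<union> (h \<circ> \<phi>) ` B \<union> D)"
    using fin D by (intro card_mono) auto
  also have "\<dots> \<le> card (g ` A) + card ((h \<circ> \<phi>) ` B) + card D"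
    by (meson add_le_mono1 card_Un_le le_trans)
  also have "\<dots> \<le> card A + card B + card D"
    using card_image_le[OF fin(1), of g] card_image_le[OF fin(2), of "h \<circ> \<phi>"] by linarith
  also have "\<dots> = card (A \<union> B) + card D"
    using fin disj by (simp add: card_Un_disjoint)
  finally have le: "card F \<le> card (A \<union> B) + card D" .
  then show "card F \<le> card X + card D"
    using card_mono[OF X(1) sub] by linarith
  show "g x \<in> F \<or> h (\<phi> x) \<in> F" if "card F = card X + card D" "x \<in> X"
  proof -
    have "A \<union> B = X"
      using le that(1) card_mono[OF X(1) sub] by (intro card_subset_eq X(1) sub) linarith
    then show ?thesis
      using that(2) by (auto simp: A_def B_def)
  qed
qed

text \<open>The left side is the count for a family with an interior member: that member, and for
  each of its \<open>r - 1\<close> consecutive pairs at most \<open>k - 1\<close> or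
  \<open>2 * k - 3\<close> paths. For \<open>r \<le> a1 + 1\<close> the margin is
  \<open>k choose 2 \<ge> k\<close>; for \<open>r = a1 + 2\<close> the term
  \<open>(a1 + 2) * (k - 1)\<close> already suffices.\<close>

lemma interior_bound_less:
  fixes k r a1 :: nat
  assumes "3 \<le> k" "3 \<le> r"
  shows "1 + (r - 1) * (if r \<le> a1 + 2 then k - 1 else 2 * k - 3) < theta_bound k a1 r"
proof -
  obtain m where m: "k = m + 2" "1 \<le> m"
    using assms by (auto simp: le_iff_add)
  have choose: "m \<le> (Suc m choose 2)" "m + 2 \<le> (Suc (Suc m) choose 2)"
  proof -
    have *: "Suc n choose 2 = n + (n choose 2)" for n
      by (simp add: numeral_2_eq_2)
    show "m \<le> (Suc m choose 2)"
      by (simp add: *)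
    show "m + 2 \<le> (Suc (Suc m) choose 2)"
      using m(2) by (simp add: *)
  qed
  consider "r \<le> a1 + 1" | "r = a1 + 2" | "a1 + 3 \<le> r"
    by linarith
  then show ?thesis
  proof cases
    case 1
    obtain s where s: "r = s + 3"
      using assms(2) by (auto simp: le_iff_add)
    have "(m + 2) * (s + 1) \<le> (Suc (Suc m) choose 2) * (s + 1)"
      using choose(2) by (rule mult_le_mono1)
    then show ?thesis
      using 1 by (simp add: m s theta_bound_def algebra_simps)
  next
    case 2
    then show ?thesis
      using m by (simp add: theta_bound_def algebra_simps)
  next
    case 3
    then obtain e where e: "r = a1 + 2 + e" "1 \<le> e"
      by (auto simp: le_iff_add)
    have "(a1 + e) * m \<le> (a1 + e) * (Suc m choose 2)"
      using choose(1) by (rule mult_le_mono2)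
    moreover have "a1 * m < (a1 + e) * m"
      using e(2) m(2) by simp
    ultimately have "a1 * m < (a1 + e) * (Suc m choose 2)"
      by linarith
    then show ?thesis
      using e(2) by (simp add: m(1) e(1) theta_bound_def power2_eq_square algebra_simps)
  qed
qed

text \<open>The assumptions are invariant under exchanging the hubs and reversing all strands. Facts
  are proved at \<open>u\<close> and carried over to \<open>v\<close> by
  \<open>reversed\<close>.\<close>

locale theta =
  fixes k :: nat and a :: "nat \<Rightarrow> nat" and u v :: 'a and w :: "nat \<Rightarrow> nat \<Rightarrow> 'a"
    and G :: "'a graph" and r :: nat
  assumes k3: "3 \<le> k"
    and a1: "1 \<le> a 1"
    and a_mono: "\<And>i j. 1 \<le> i \<Longrightarrow> i \<le> j \<Longrightarrow> j \<le> k \<Longrightarrow> a i \<le> a j"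
    and r3: "3 \<le> r"
    and r_le: "2 * r \<le> a 1 + a 2 + 1"
    and w_0: "\<And>i. 1 \<le> i \<Longrightarrow> i \<le> k \<Longrightarrow> w i 0 = u"
    and w_a: "\<And>i. 1 \<le> i \<Longrightarrow> i \<le> k \<Longrightarrow> w i (a i) = v"
    and w_inj: "\<And>i. 1 \<le> i \<Longrightarrow> i \<le> k \<Longrightarrow> inj_on (w i) {0..a i}"
    and w_disj: "\<And>i j. 1 \<le> i \<Longrightarrow> i \<le> k \<Longrightarrow> 1 \<le> j \<Longrightarrow> j \<le> k \<Longrightarrow> i \<noteq> j \<Longrightarrow>
      w i ` {0..a i} \<inter> w j ` {0..a j} = {u, v}"
    \<comment> \<open>beyond the last vertex a strand is constant, so that reversing it twice is the identity\<close>
    and w_min: "\<And>i n. w i (min n (a i)) = w i n"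
    and verts_G: "verts G = (\<Union>i\<in>{1..k}. w i ` {0..a i})"
    and edges_G: "edges G = {{w i n, w i (Suc n)} | i n. 1 \<le> i \<and> i \<le> k \<and> n < a i}"
begin

abbreviation "w' \<equiv> flip a w"

text \<open>Truncated subtraction sends a position beyond the end to \<open>min n (a i)\<close>. The
  identity is one of functions, so that applying \<open>reversed\<close> twice leads back to the
  original terms.\<close>

lemma flip_flip: "flip a w' = w"
proof (intro ext)
  fix i n
  have "a i - (a i - n) = min n (a i)"
    by auto
  then show "flip a w' i n = w i n"
    by (simp only: flip_def w_min)
qed

lemma reversed: "theta k a v u w' G r"
proof
  show "inj_on (w' i) {0..a i}" if "1 \<le> i" "i \<le> k" for i
  proof (rule inj_onI)
    fix n m assume "n \<in> {0..a i}" "m \<in> {0..a i}" "w' i n = w' i m"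
    moreover from this have "a i - n = a i - m"
      by (intro inj_onD[OF w_inj[OF that]]) (auto simp: flip_def)
    ultimately show "n = m"
      by auto
  qed
  have im: "w' i ` {0..a i} = w i ` {0..a i}" for i
  proof -
    have "(\<lambda>n. a i - n) ` {0..a i} = {0..a i}"
    proof (intro equalityI subsetI)
      show "n \<in> (\<lambda>n. a i - n) ` {0..a i}" if "n \<in> {0..a i}" for n
        using that by (intro image_eqI[of _ _ "a i - n"]) auto
    qed auto
    then show ?thesis
      unfolding flip_def by (metis image_image)
  qed
  show "w' i ` {0..a i} \<inter> w' j ` {0..a j} = {v, u}"
    if "1 \<le> i" "i \<le> k" "1 \<le> j" "j \<le> k" "i \<noteq> j" for i j
    using w_disj[OF that] by (simp add: im insert_commute)
  show "verts G = (\<Union>i\<in>{1..k}. w' i ` {0..a i})"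
    by (simp add: im verts_G)
  have *: "{{w i n, w i (Suc n)} | i n. 1 \<le> i \<and> i \<le> k \<and> n < a i}
    \<subseteq> {{flip a w i n, flip a w i (Suc n)} | i n. 1 \<le> i \<and> i \<le> k \<and> n < a i}" for w :: "nat \<Rightarrow> nat \<Rightarrow> 'a"
  proof safe
    fix i n assume "1 \<le> i" "i \<le> k" "n < a i"
    then show "\<exists>j m. {w i n, w i (Suc n)} = {flip a w j m, flip a w j (Suc m)} \<and> 1 \<le> j \<and> j \<le> k \<and> m < a j"
      by (intro exI[of _ i] exI[of _ "a i - Suc n"]) (auto simp: flip_def Suc_diff_Suc)
  qed
  show "edges G = {{w' i n, w' i (Suc n)} | i n. 1 \<le> i \<and> i \<le> k \<and> n < a i}"
    using *[of w] *[of w'] by (simp add: edges_G flip_flip)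
qed (use k3 a1 a_mono r3 r_le w_0 w_a in \<open>auto simp: flip_def min_def\<close>)

text \<open>The last claim follows from \<open>2 * r \<le> a 1 + a 2 + 1 \<le> 2 * a 2 + 1\<close>.
  Any strand but the first thus has more than \<open>r\<close> vertices, so no \<open>r\<close>-path
  contains it entirely.\<close>

lemma a_ge: "1 \<le> i \<Longrightarrow> i \<le> k \<Longrightarrow> 1 \<le> a i" "2 \<le> i \<Longrightarrow> i \<le> k \<Longrightarrow> a 2 \<le> a i" "2 \<le> i \<Longrightarrow> i \<le> k \<Longrightarrow> r \<le> a i"
  using a_mono[of 1 i] a_mono[of 2 i] a_mono[of 1 2] a1 r_le k3 by auto

lemma a_sum: "2 \<le> i \<Longrightarrow> i \<le> k \<Longrightarrow> 2 * r \<le> a 1 + a i + 1"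
  using a_ge(2)[of i] r_le by auto

text \<open>Different coordinates name the same vertex only at a hub; this reduces later questions
  about intersections to arithmetic on positions.\<close>

lemma w_eq_iff:
  assumes "1 \<le> i" "i \<le> k" "1 \<le> j" "j \<le> k" "n \<le> a i" "m \<le> a j"
  shows "w i n = w j m \<longleftrightarrow> (i = j \<and> n = m) \<or> (n = 0 \<and> m = 0) \<or> (n = a i \<and> m = a j)"
proof (cases "i = j")
  case True
  then show ?thesis
    using w_inj[of i] assms by (auto simp: inj_on_def)
next
  case False
  have "n = 0 \<or> n = a i" "m = 0 \<or> m = a j" if "w i n = w j m"
  proof -
    have "w i n \<in> w i ` {0..a i}" "w j m \<in> w j ` {0..a j}"
      using assms by (auto intro!: imageI)
    then have "w i n \<in> {u, v}"
      using w_disj[of i j] assms False that by (metis IntI)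
    then have "w i n = u \<or> w i n = v"
      by simp
    then have "w i n = w i 0 \<or> w i n = w i (a i)" "w j m = w j 0 \<or> w j m = w j (a j)"
      using w_0 w_a assms that by auto
    then show "n = 0 \<or> n = a i" "m = 0 \<or> m = a j"
      using w_inj[of i] w_inj[of j] assms by (auto dest!: inj_onD)
  qed
  moreover have "w i 0 \<noteq> w i (a i)"
    using w_inj[of i] a_ge(1)[of i] assms by (auto dest!: inj_onD)
  then have "u \<noteq> v"
    using w_0 w_a assms by simp
  ultimately show ?thesis
    using False w_0 w_a assms by auto
qed

lemma adjD:
  assumes "{x, y} \<in> edges G"
  obtains i n where "1 \<le> i" "i \<le> k" "Suc n \<le> a i"
    "(x = w i n \<and> y = w i (Suc n)) \<or> (x = w i (Suc n) \<and> y = w i n)"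
  using assms unfolding edges_G by (auto simp: doubleton_eq_iff Suc_le_eq)

lemma adj_inner:
  assumes "{w i n, y} \<in> edges G" "1 \<le> i" "i \<le> k" "0 < n" "n < a i"
  shows "y = w i (n - 1) \<or> y = w i (Suc n)"
  using assms(1)
proof (rule adjD)
  fix j m assume j: "1 \<le> j" "j \<le> k" "Suc m \<le> a j"
    and *: "(w i n = w j m \<and> y = w j (Suc m)) \<or> (w i n = w j (Suc m) \<and> y = w j m)"
  show ?thesis
    using * w_eq_iff[of i j n m] w_eq_iff[of i j n "Suc m"] j assms by auto
qed

lemma adj_u:
  assumes "{u, y} \<in> edges G"
  obtains j where "1 \<le> j" "j \<le> k" "y = w j 1"
  using assms
proof (rule adjD)
  fix j m assume j: "1 \<le> j" "j \<le> k" "Suc m \<le> a j"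
    and *: "(u = w j m \<and> y = w j (Suc m)) \<or> (u = w j (Suc m) \<and> y = w j m)"
  then show ?thesis
    using * w_eq_iff[of j j 0 m] w_eq_iff[of j j 0 "Suc m"] j w_0[of j] that by auto
qed

lemma adj_v:
  assumes "{v, y} \<in> edges G"
  obtains j where "1 \<le> j" "j \<le> k" "y = w' j 1"
  using theta.adj_u[OF reversed assms] by blast

abbreviation "walk xs \<equiv> distinct xs \<and> successively (\<lambda>x y. {x, y} \<in> edges G) xs"

text \<open>Inner vertices of a strand have degree two and a path cannot turn back, so a single step
  along a strand determines the walk up to \<open>v\<close>. In the second alternative
  \<open>zs\<close> is the part after \<open>v\<close>.\<close>

lemma ray:
  assumes "walk (x # y # ys)" "1 \<le> i" "i \<le> k" "Suc n \<le> a i" "x = w i n" "y = w i (Suc n)"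
  shows "(Suc n + length ys \<le> a i \<and> x # y # ys = map (w i) [n..<n + 2 + length ys]) \<or>
    (\<exists>zs. zs \<noteq> [] \<and> x # y # ys = map (w i) [n..<Suc (a i)] @ zs)"
  using assms
proof (induction ys arbitrary: x y n)
  case Nil
  then show ?case
    by (simp add: upt_rec)
next
  case (Cons z zs)
  show ?case
  proof (cases "Suc n = a i")
    case True
    then have "x # y # z # zs = map (w i) [n..<Suc (a i)] @ z # zs"
      using Cons.prems by (simp flip: True)
    then show ?thesis
      by blast
  next
    case False
    then have "z = w i n \<or> z = w i (Suc (Suc n))"
      using Cons.prems adj_inner[of i "Suc n" z] by auto
    then have "z = w i (Suc (Suc n))"
      using Cons.prems by auto
    then have "(Suc (Suc n) + length zs \<le> a i \<and> y # z # zs = map (w i) [Suc n..<Suc n + 2 + length zs]) \<or>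
      (\<exists>zs'. zs' \<noteq> [] \<and> y # z # zs = map (w i) [Suc n..<Suc (a i)] @ zs')"
      using Cons.IH[of y z "Suc n"] Cons.prems False by auto
    moreover have "[n..<n + 2 + length (z # zs)] = n # [Suc n..<Suc n + 2 + length zs]"
      by (subst upt_rec) auto
    moreover have "[n..<Suc (a i)] = n # [Suc n..<Suc (a i)]"
      using Cons.prems by (subst upt_rec) auto
    ultimately show ?thesis
      using Cons.prems by (auto simp del: upt_Suc)
  qed
qed

section \<open>Classification of the paths on r vertices\<close>

lemma seg_flip:
  assumes "n + r \<le> Suc (a i)"
  shows "seg_path r w' i n = seg_path r w i (Suc (a i) - r - n)"
proof -
  have "map (w' i) [n..<n + r] = rev (map (w i) [Suc (a i) - r - n..<Suc (a i) - r - n + r])"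
    using assms by (intro nth_equalityI) (auto simp: flip_def rev_nth intro!: arg_cong[of _ _ "w i"])
  then show ?thesis
    by (simp add: seg_path_def)
qed

lemma bridge_flip: "bridge_path a w' j \<beta> i \<alpha> = bridge_path a w i \<alpha> j \<beta>"
proof -
  have "rev (bridge_list a w' j \<beta> i \<alpha>) = bridge_list a w i \<alpha> j \<beta>"
    using rev_map_flip[of "a 1" a 1 w]
    by (simp add: bridge_list_def flip_flip rev_map del: upt_Suc)
  then show ?thesis
    by (metis bridge_path_def walk_graph_rev)
qed

text \<open>Choices exist only at the hubs, so \<open>ray\<close> is applied on up to three strands
  in turn: from the start to \<open>v\<close>, from \<open>v\<close> along \<open>l\<close>, and
  from \<open>u\<close> along \<open>m\<close>.\<close>

lemma asc_cases:
  assumes "walk (x # y # ys)" "length (x # y # ys) = r" "1 \<le> i" "i \<le> k" "Suc n \<le> a i"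
    "x = w i n" "y = w i (Suc n)"
  obtains (seg) "walk_graph (x # y # ys) = seg_path r w i n" "n + r \<le> Suc (a i)"
  | (hub) l \<delta> where "1 \<le> l" "l \<le> k" "l \<noteq> i" "1 \<le> \<delta>" "\<delta> \<le> a l" "(a i - n) + \<delta> + 1 = r"
      "walk_graph (x # y # ys) = hub_path w' i (a i - n) l \<delta>"
  | (bridge) m \<beta> where "2 \<le> i" "2 \<le> m" "m \<le> k" "1 \<le> \<beta>" "\<beta> + a 1 + (a i - n) + 1 = r"
      "walk_graph (x # y # ys) = bridge_path a w m \<beta> i (a i - n)"
  using ray[OF assms(1,3-7)]
proof (elim disjE conjE exE)
  assume "Suc n + length ys \<le> a i" "x # y # ys = map (w i) [n..<n + 2 + length ys]"
  moreover have "2 + length ys = r"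
    using assms by simp
  ultimately show thesis
    by (intro seg) (auto simp: seg_path_def add.assoc simp del: upt_Suc)
next
  fix zs assume "zs \<noteq> []" and xs: "x # y # ys = map (w i) [n..<Suc (a i)] @ zs"
  then obtain z zs' where zs: "zs = z # zs'"
    by (cases zs) auto
  have "[n..<Suc (a i)] = [n..<a i] @ [a i]"
    using assms by simp
  then have xs': "x # y # ys = map (w i) [n..<a i] @ v # z # zs'"
    using xs zs w_a assms by simp
  have walk_v: "walk (v # z # zs')"
    using assms(1) unfolding xs' by (simp add: successively_append_iff)
  then obtain l where l: "1 \<le> l" "l \<le> k" "z = w' l 1"
    using adj_v[of z] by auto
  have "l \<noteq> i"
  proof
    assume "l = i"
    then have "z \<in> set (map (w i) [n..<a i])"
      using l assms by (auto simp: flip_def)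
    then show False
      using assms(1) unfolding xs' by auto
  qed
  have first: "map (w i) [n..<a i] = rev (map (w' i) [1..<Suc (a i - n)])"
    using rev_map_flip_Suc[of "a i - n" a i w] assms by (simp del: upt_Suc)
  have len: "length (map (w i) [n..<a i]) + length (v # z # zs') = r"
    using assms(2) unfolding xs' by simp
  have "Suc 0 \<le> a l" "v = w' l 0" "z = w' l (Suc 0)"
    using l w_a a_ge(1)[of l] by (auto simp: flip_def)
  from theta.ray[OF reversed walk_v l(1,2) this] show thesis
  proof (elim disjE conjE exE)
    assume *: "Suc 0 + length zs' \<le> a l" "v # z # zs' = map (w' l) [0..<0 + 2 + length zs']"
    then have "x # y # ys = hub_list w' i (a i - n) l (Suc (length zs'))"
      unfolding xs' first by (simp add: hub_list_def del: upt_Suc)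
    moreover have "a i - n + Suc (length zs') + 1 = r"
      using len by simp
    ultimately show thesis
      using l * \<open>l \<noteq> i\<close> by (intro hub[of l "Suc (length zs')"]) (auto simp: hub_path_def)
  next
    fix zs2 assume "zs2 \<noteq> []" and vz: "v # z # zs' = map (w' l) [0..<Suc (a l)] @ zs2"
    then obtain t ts where ts: "zs2 = t # ts"
      by (cases zs2) auto
    \<comment> \<open>The walk contains all of strand \<open>l\<close> and one more vertex, so this
      strand has fewer than \<open>r\<close> edges and must be the first.\<close>
    have "length (v # z # zs') \<ge> a l + 2"
      unfolding vz ts by simp
    then have "a l < r"
      using len by simp
    then have "l = 1"
      using a_ge(3)[of l] l by force
    have vz': "v # z # zs' = map (w' 1) [0..<a 1] @ u # t # ts"
      using vz w_0[of 1] \<open>l = 1\<close> l by (simp add: ts flip_def)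
    have walk_u: "walk (u # t # ts)"
      using walk_v unfolding vz' by (simp add: successively_append_iff)
    then obtain m where m: "1 \<le> m" "m \<le> k" "t = w m 1"
      using adj_u[of t] by auto
    have "m \<noteq> 1"
    proof
      assume "m = 1"
      then have "t \<in> set (map (w' 1) [0..<a 1])"
        using m a1 by (auto simp: flip_def intro!: image_eqI[of _ _ "a 1 - 1"])
      then show False
        using walk_v unfolding vz' by auto
    qed
    have "Suc 0 \<le> a m" "u = w m 0" "t = w m (Suc 0)"
      using m w_0 a_ge(1)[of m] by auto
    from ray[OF walk_u m(1,2) this] show thesis
    proof (elim disjE conjE exE)
      assume *: "Suc 0 + length ts \<le> a m" "u # t # ts = map (w m) [0..<0 + 2 + length ts]"
      have "map (w' 1) [0..<a 1] @ map (w m) [0..<Suc (Suc (length ts))]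
        = rev (map (w 1) [0..<Suc (a 1)]) @ map (w m) [1..<Suc (Suc (length ts))]"
      proof -
        have "rev (map (w 1) [0..<Suc (a 1)]) = map (w' 1) [0..<Suc (a 1)]"
          using rev_map_flip[of "a 1" a 1 w] by (simp del: upt_Suc)
        also have "\<dots> = map (w' 1) [0..<a 1] @ [w m 0]"
          using w_0[of 1] w_0[of m] m k3 by (simp add: flip_def)
        finally show ?thesis
          by (simp add: upt_conv_Cons del: upt_Suc)
      qed
      then have "x # y # ys = rev (bridge_list a w m (Suc (length ts)) i (a i - n))"
        using * unfolding xs' vz' first by (simp add: bridge_list_def del: upt_Suc)
      moreover have "length (map (w i) [n..<a i]) + length (map (w' 1) [0..<a 1] @ u # t # ts) = r"
        using len unfolding vz' .
      ultimately show thesis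
        using \<open>l = 1\<close> \<open>l \<noteq> i\<close> \<open>m \<noteq> 1\<close> m assms
        by (intro bridge[of m "Suc (length ts)"]) (auto simp: bridge_path_def)
    next
      \<comment> \<open>A further complete passage is impossible: since \<open>m \<noteq> 1\<close>,
        strand \<open>m\<close> alone has more than \<open>r\<close> vertices.\<close>
      fix zs3 assume u: "u # t # ts = map (w m) [0..<Suc (a m)] @ zs3"
      have "length (u # t # ts) \<ge> Suc (a m)"
        unfolding u by simp
      moreover have "length (u # t # ts) \<le> length (v # z # zs')"
        unfolding vz' by simp
      ultimately show thesis
        using len a_ge(3)[of m] m \<open>m \<noteq> 1\<close> by simp
    qed
  qed
qed

text \<open>A descending first step is an ascending one in the reversed graph; this exchanges the
  two hub cases and keeps segments and bridges. An arm of a hub path may be the whole first strand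
  and so end in the other hub.\<close>

theorem path_cases:
  assumes "P \<in> paths_on r G"
  obtains (seg) i s where "1 \<le> i" "i \<le> k" "s + r \<le> Suc (a i)" "P = seg_path r w i s"
  | (hub_u) i \<alpha> j \<beta> where "1 \<le> i" "i \<le> k" "1 \<le> j" "j \<le> k" "i \<noteq> j" "1 \<le> \<alpha>" "\<alpha> \<le> a i"
      "1 \<le> \<beta>" "\<beta> \<le> a j" "\<alpha> + \<beta> + 1 = r" "P = hub_path w i \<alpha> j \<beta>"
  | (hub_v) i \<alpha> j \<beta> where "1 \<le> i" "i \<le> k" "1 \<le> j" "j \<le> k" "i \<noteq> j" "1 \<le> \<alpha>" "\<alpha> \<le> a i"
      "1 \<le> \<beta>" "\<beta> \<le> a j" "\<alpha> + \<beta> + 1 = r" "P = hub_path w' i \<alpha> j \<beta>"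
  | (bridge) i \<alpha> j \<beta> where "2 \<le> i" "i \<le> k" "2 \<le> j" "j \<le> k" "1 \<le> \<alpha>" "1 \<le> \<beta>"
      "\<alpha> + a 1 + \<beta> + 1 = r" "P = bridge_path a w i \<alpha> j \<beta>"
proof -
  obtain xs where xs: "xs \<noteq> []" "distinct xs" "P = walk_graph xs" "subgraph (walk_graph xs) G"
    "length xs = r"
    using assms by (auto simp: paths_on_def is_path_def distinct_card)
  then obtain x y ys where eq: "xs = x # y # ys"
    using r3 by (cases xs; cases "tl xs") auto
  have w: "walk (x # y # ys)"
    using xs walk_graph_subgraph_iff[of xs G] eq by auto
  have l: "length (x # y # ys) = r"
    using xs eq by simp
  have "{x, y} \<in> edges G"
    using w by simp
  then show thesis
  proof (rule adjD, elim disjE conjE)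
    fix i n assume i: "1 \<le> i" "i \<le> k" "Suc n \<le> a i" "x = w i n" "y = w i (Suc n)"
    show thesis
      using w l i
    proof (cases rule: asc_cases)
      case seg
      then show thesis using that(1)[of i n] i xs eq by auto
    next
      case (hub l \<delta>)
      then show thesis using that(3)[of i l "a i - n" \<delta>] i xs eq by auto
    next
      case (bridge m \<beta>)
      then show thesis using that(4)[of m i \<beta> "a i - n"] i xs eq by auto
    qed
  next
    fix i n assume i: "1 \<le> i" "i \<le> k" "Suc n \<le> a i" "x = w i (Suc n)" "y = w i n"
    then have "Suc (a i - Suc n) \<le> a i" "x = w' i (a i - Suc n)" "y = w' i (Suc (a i - Suc n))"
      by (auto simp: flip_def Suc_diff_Suc)
    with w l i(1,2) show thesis
    proof (cases rule: theta.asc_cases[OF reversed, consumes 7, case_names seg hub bridge])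
      case seg
      then show thesis
        using that(1)[of i "Suc (a i) - r - (a i - Suc n)"] i xs eq seg_flip[of "a i - Suc n" i] by auto
    next
      case (hub l \<delta>)
      then show thesis using that(2)[of i l "Suc n" \<delta>] i xs eq by (auto simp: flip_flip)
    next
      case (bridge m \<beta>)
      then show thesis
        using that(4)[of i m "Suc n" \<beta>] i xs eq by (auto simp: bridge_flip)
    qed
  qed
qed

section \<open>Membership of a vertex in each kind of path, in strand coordinates\<close>

lemma mem_seg:
  assumes "1 \<le> i" "i \<le> k" "s + r \<le> Suc (a i)" "1 \<le> l" "l \<le> k" "n \<le> a l"
  shows "w l n \<in> verts (seg_path r w i s) \<longleftrightarrow>
    (l = i \<and> s \<le> n \<and> n < s + r) \<or> (n = 0 \<and> s = 0) \<or> (n = a l \<and> s + r = Suc (a i))"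
proof -
  have "w l n \<in> verts (seg_path r w i s) \<longleftrightarrow> (\<exists>m. s \<le> m \<and> m < s + r \<and> w l n = w i m)"
    by (auto simp: seg_path_def)
  also have "\<dots> \<longleftrightarrow> (\<exists>m. s \<le> m \<and> m < s + r \<and>
      ((l = i \<and> n = m) \<or> (n = 0 \<and> m = 0) \<or> (n = a l \<and> m = a i)))"
    using assms by (intro ex_cong1 conj_cong refl w_eq_iff) auto
  also have "\<dots> \<longleftrightarrow> (l = i \<and> s \<le> n \<and> n < s + r) \<or> (n = 0 \<and> s = 0) \<or> (n = a l \<and> s + r = Suc (a i))"
    using assms r3 by (auto; presburger)
  finally show ?thesis .
qed

lemma mem_arm:
  assumes "1 \<le> i" "i \<le> k" "1 \<le> l" "l \<le> k" "n \<le> a l" "\<alpha> \<le> a i"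
  shows "w l n \<in> w i ` {0..\<alpha>} \<longleftrightarrow> n = 0 \<or> (l = i \<and> n \<le> \<alpha>) \<or> (n = a l \<and> \<alpha> = a i)"
proof -
  have "w l n \<in> w i ` {0..\<alpha>} \<longleftrightarrow> (\<exists>m\<le>\<alpha>. w l n = w i m)"
    by auto
  also have "\<dots> \<longleftrightarrow> (\<exists>m\<le>\<alpha>. (l = i \<and> n = m) \<or> (n = 0 \<and> m = 0) \<or> (n = a l \<and> m = a i))"
    using assms by (intro ex_cong1 conj_cong refl w_eq_iff) auto
  also have "\<dots> \<longleftrightarrow> n = 0 \<or> (l = i \<and> n \<le> \<alpha>) \<or> (n = a l \<and> \<alpha> = a i)"
    using assms by auto
  finally show ?thesis .
qed

lemma verts_hub:
  assumes "1 \<le> i" "i \<le> k" "1 \<le> j" "j \<le> k"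
  shows "verts (hub_path w i \<alpha> j \<beta>) = w i ` {0..\<alpha>} \<union> w j ` {0..\<beta>}"
proof -
  have "{0..\<alpha>} = insert 0 {1..<Suc \<alpha>}"
    by auto
  moreover have "w i 0 \<in> w j ` {0..\<beta>}"
    using w_0[of i] w_0[of j] assms by (intro image_eqI[of _ _ 0]) auto
  ultimately show ?thesis
    by (auto simp: hub_path_def hub_list_def atLeastLessThanSuc_atLeastAtMost simp del: upt_Suc)
qed

lemma mem_hub:
  assumes "1 \<le> i" "i \<le> k" "1 \<le> j" "j \<le> k" "1 \<le> l" "l \<le> k" "n \<le> a l" "\<alpha> \<le> a i" "\<beta> \<le> a j"
  shows "w l n \<in> verts (hub_path w i \<alpha> j \<beta>) \<longleftrightarrow>
    n = 0 \<or> (l = i \<and> n \<le> \<alpha>) \<or> (l = j \<and> n \<le> \<beta>) \<or> (n = a l \<and> (\<alpha> = a i \<or> \<beta> = a j))"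
  using assms by (auto simp: verts_hub mem_arm)

lemma w_conv_flip: "n \<le> a l \<Longrightarrow> w l n = w' l (a l - n)"
  by (simp add: flip_def)

lemma mem_hub_flip:
  assumes "1 \<le> i" "i \<le> k" "1 \<le> j" "j \<le> k" "1 \<le> l" "l \<le> k" "n \<le> a l" "\<alpha> \<le> a i" "\<beta> \<le> a j"
  shows "w l n \<in> verts (hub_path w' i \<alpha> j \<beta>) \<longleftrightarrow>
    n = a l \<or> (l = i \<and> a l - n \<le> \<alpha>) \<or> (l = j \<and> a l - n \<le> \<beta>) \<or> (n = 0 \<and> (\<alpha> = a i \<or> \<beta> = a j))"
  using theta.mem_hub[OF reversed, of i j l "a l - n" \<alpha> \<beta>] assms by (auto simp: w_conv_flip)

lemma mem_bridge:
  assumes "1 \<le> i" "i \<le> k" "1 \<le> j" "j \<le> k" "1 \<le> l" "l \<le> k" "n \<le> a l" "\<alpha> < a i" "\<beta> < a j"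
  shows "w l n \<in> verts (bridge_path a w i \<alpha> j \<beta>) \<longleftrightarrow>
    n = 0 \<or> n = a l \<or> l = 1 \<or> (l = i \<and> n \<le> \<alpha>) \<or> (l = j \<and> a l - n \<le> \<beta>)"
proof -
  have "{0..\<alpha>} = insert 0 {1..<Suc \<alpha>}" "{0..\<beta>} = insert 0 {1..<Suc \<beta>}"
    by auto
  moreover have "w i 0 = w 1 0" "w' j 0 = w 1 (a 1)"
    using assms w_0[of 1] w_0[of i] w_a[of 1] w_a[of j] by (auto simp: flip_def)
  ultimately have "verts (bridge_path a w i \<alpha> j \<beta>) = w i ` {0..\<alpha>} \<union> w 1 ` {0..a 1} \<union> w' j ` {0..\<beta>}"
    by (auto simp: bridge_path_def bridge_list_def less_Suc_eq_le simp del: upt_Suc)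
  then show ?thesis
    using assms theta.mem_arm[OF reversed, of j l "a l - n" \<beta>]
    by (auto simp: mem_arm w_conv_flip[symmetric])
qed

section \<open>The listed walks are paths of the graph\<close>

lemma walk_in_paths:
  assumes "walk xs" "length xs = r" "set xs \<subseteq> verts G"
  shows "walk_graph xs \<in> paths_on r G"
proof -
  have "xs \<noteq> []"
    using assms r3 by auto
  then show ?thesis
    using assms walk_graph_subgraph_iff[of xs G] unfolding paths_on_def is_path_def
    by (auto simp: distinct_card)
qed

lemma w_in_verts: "1 \<le> i \<Longrightarrow> i \<le> k \<Longrightarrow> w i n \<in> verts G"
  unfolding verts_G using w_min[of i n] by (auto intro!: bexI[of _ i] image_eqI[of _ _ "min n (a i)"])

lemma edge_w: "1 \<le> i \<Longrightarrow> i \<le> k \<Longrightarrow> n < a i \<Longrightarrow> {w i n, w i (Suc n)} \<in> edges G"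
  unfolding edges_G by blast

lemma walk_strand:
  assumes "1 \<le> i" "i \<le> k" "m \<le> Suc (a i)"
  shows "walk (map (w i) [n..<m])"
proof
  show "distinct (map (w i) [n..<m])"
    using assms by (auto simp: distinct_map intro: inj_on_subset[OF w_inj])
  show "successively (\<lambda>x y. {x, y} \<in> edges G) (map (w i) [n..<m])"
    using assms by (auto simp: successively_conv_nth intro!: edge_w)
qed

lemma successively_rev_edges:
  "successively (\<lambda>x y. {x, y} \<in> edges G) (rev xs) \<longleftrightarrow> successively (\<lambda>x y. {x, y} \<in> edges G) xs"
  by (simp add: insert_commute)

text \<open>If both arms were whole strands, \<open>v\<close> would occur twice; hence the strict
  bound on \<open>\<alpha>\<close> next to the weak one on \<open>\<beta>\<close>. The case
  \<open>\<beta> = a j\<close> serves the bridges.\<close>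

lemma walk_hub_list:
  assumes "1 \<le> i" "i \<le> k" "1 \<le> j" "j \<le> k" "i \<noteq> j" "\<alpha> < a i" "\<beta> \<le> a j"
  shows "walk (hub_list w i \<alpha> j \<beta>)"
proof
  have wi: "walk (map (w i) [1..<Suc \<alpha>])" and wj: "walk (map (w j) [0..<Suc \<beta>])"
    using assms walk_strand[of i "Suc \<alpha>" 1] walk_strand[of j "Suc \<beta>" 0] by auto
  have "w i n \<noteq> w j m" if "1 \<le> n" "n \<le> \<alpha>" "m \<le> \<beta>" for n m
    using w_eq_iff[of i j n m] assms that by auto
  then show "distinct (hub_list w i \<alpha> j \<beta>)"
    using wi wj by (auto simp: hub_list_def simp del: upt_Suc)
  have "{w i (Suc 0), w j 0} \<in> edges G" if "1 \<le> \<alpha>"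
    using edge_w[of i 0] w_0[of i] w_0[of j] assms that by (simp add: insert_commute)
  then show "successively (\<lambda>x y. {x, y} \<in> edges G) (hub_list w i \<alpha> j \<beta>)"
    using wi wj
    by (cases "\<alpha> = 0")
      (auto simp: hub_list_def successively_append_iff last_rev hd_map successively_rev_edges
        simp del: upt_Suc successively_rev)
qed

lemma hub_in_paths:
  assumes "1 \<le> i" "i \<le> k" "1 \<le> j" "j \<le> k" "i \<noteq> j" "\<alpha> < a i" "\<beta> \<le> a j" "\<alpha> + \<beta> + 1 = r"
  shows "hub_path w i \<alpha> j \<beta> \<in> paths_on r G"
  unfolding hub_path_def using assms
  by (intro walk_in_paths walk_hub_list) (auto simp: hub_list_def w_in_verts)

text \<open>A bridge is a hub path whose second arm is the whole first strand, prolonged beyond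
  \<open>v\<close>.\<close>

lemma bridge_in_paths:
  assumes "2 \<le> i" "i \<le> k" "2 \<le> j" "j \<le> k" "\<alpha> + a 1 + \<beta> + 1 = r"
  shows "bridge_path a w i \<alpha> j \<beta> \<in> paths_on r G"
proof -
  \<comment> \<open>The third inequality is for \<open>i = j\<close>, where the arms approach each
    other from the two ends of one strand.\<close>
  have a: "\<alpha> < a i" "\<beta> < a j" "\<alpha> + \<beta> < a i"
    using assms a_ge(3)[of i] a_ge(3)[of j] a1 by auto
  have eq: "bridge_list a w i \<alpha> j \<beta> = hub_list w i \<alpha> 1 (a 1) @ map (w' j) [1..<Suc \<beta>]"
    by (simp add: bridge_list_def hub_list_def del: upt_Suc)
  have hub: "walk (hub_list w i \<alpha> 1 (a 1))"
    using assms a k3 by (intro walk_hub_list) auto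
  have arm: "walk (map (w' j) [1..<Suc \<beta>])"
    using assms a by (intro theta.walk_strand[OF reversed]) auto
  have "w j (a j - n) \<notin> verts (hub_path w i \<alpha> 1 (a 1))" if "1 \<le> n" "n \<le> \<beta>" for n
    using mem_hub[of i 1 j "a j - n" \<alpha> "a 1"] assms a that by auto
  then have "distinct (bridge_list a w i \<alpha> j \<beta>)"
    using hub arm unfolding eq by (auto simp: hub_path_def flip_def simp del: upt_Suc)
  moreover have *: "{w 1 (a 1), w' j (Suc 0)} \<in> edges G"
    using edge_w[of j "a j - 1"] w_a[of 1] w_a[of j] a assms k3 by (auto simp: flip_def insert_commute)
  have "successively (\<lambda>x y. {x, y} \<in> edges G) (bridge_list a w i \<alpha> j \<beta>)"
  proof -
    have "last (hub_list w i \<alpha> 1 (a 1)) = w 1 (a 1)"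
      by (simp add: hub_list_def)
    with hub arm * show ?thesis
      unfolding eq by (cases "\<beta> = 0") (auto simp: successively_append_iff hd_map simp del: upt_Suc)
  qed
  moreover have "set (bridge_list a w i \<alpha> j \<beta>) \<subseteq> verts G"
    using w_in_verts[of i] w_in_verts[of j] w_in_verts[of 1] assms k3
    by (auto simp: bridge_list_def flip_def simp del: upt_Suc)
  ultimately show ?thesis
    unfolding bridge_path_def using assms by (intro walk_in_paths) (auto simp: bridge_list_def)
qed

section \<open>Enumeration of the hub stars\<close>

text \<open>
  A triple \<open>(i, \<alpha>, j)\<close> stands for the path whose arms from a hub have \<open>\<alpha>\<close> edges on strand \<open>i\<close> and
  \<open>r - 1 - \<alpha>\<close> edges on strand \<open>j\<close>. For \<open>\<alpha> = 0\<close> the strand \<open>i\<close> does not matter and is normalised.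
\<close>

definition hub_index :: "(nat \<times> nat \<times> nat) set" where
  "hub_index = {(i, \<alpha>, j). 1 \<le> i \<and> i \<le> k \<and> 1 \<le> j \<and> j \<le> k \<and> \<alpha> + 2 \<le> r \<and> \<alpha> < a i \<and>
    r - 1 - \<alpha> < a j \<and> (if \<alpha> = 0 then i = (if j = 1 then 2 else 1) else i < j)}"

text \<open>The arms are told apart by their hubs, so no order of \<open>i\<close> and
  \<open>j\<close> is imposed and \<open>i = j\<close> occurs. An empty arm is assigned to strand 2
  by convention.\<close>

definition bridge_index :: "(nat \<times> nat \<times> nat) set" where
  "bridge_index = {(i, \<alpha>, j). 2 \<le> i \<and> i \<le> k \<and> 2 \<le> j \<and> j \<le> k \<and> \<alpha> + a 1 + 1 \<le> r \<and>
    (\<alpha> = 0 \<longrightarrow> i = 2) \<and> (\<alpha> + a 1 + 1 = r \<longrightarrow> j = 2)}"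

lemma hub_indexD:
  assumes "(i, \<alpha>, j) \<in> hub_index"
  shows "1 \<le> i" "i \<le> k" "1 \<le> j" "j \<le> k" "\<alpha> + 2 \<le> r" "\<alpha> < a i" "r - 1 - \<alpha> < a j" "i \<noteq> j"
  using assms by (auto simp: hub_index_def split: if_splits)

lemma bridge_indexD:
  assumes "(i, \<alpha>, j) \<in> bridge_index"
  shows "2 \<le> i" "i \<le> k" "2 \<le> j" "j \<le> k" "\<alpha> + a 1 + 1 \<le> r" "\<alpha> < a i" "r - 1 - a 1 - \<alpha> < a j"
    "1 \<le> i" "1 \<le> j"
  using assms a_ge(3)[of i] a_ge(3)[of j] r3 a1 by (auto simp: bridge_index_def)

lemma mem_hub_of:
  assumes "(i, \<alpha>, j) \<in> hub_index" "1 \<le> l" "l \<le> k" "n \<le> a l"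
  shows "w l n \<in> verts (hub_of r w (i, \<alpha>, j)) \<longleftrightarrow>
    n = 0 \<or> (l = i \<and> n \<le> \<alpha>) \<or> (l = j \<and> n \<le> r - 1 - \<alpha>)"
  using hub_indexD[OF assms(1)] assms(2-) by (auto simp: hub_of_def mem_hub)

lemma mem_bridge_of:
  assumes "(i, \<alpha>, j) \<in> bridge_index" "1 \<le> l" "l \<le> k" "n \<le> a l"
  shows "w l n \<in> verts (bridge_of a r w (i, \<alpha>, j)) \<longleftrightarrow>
    n = 0 \<or> n = a l \<or> l = 1 \<or> (l = i \<and> n \<le> \<alpha>) \<or> (l = j \<and> a l - n \<le> r - 1 - a 1 - \<alpha>)"
  using bridge_indexD[OF assms(1)] assms(2-) unfolding bridge_of_def prod.case
  by (intro mem_bridge) auto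

lemma u_eq: "u = w 1 0" and v_eq: "v = w 1 (a 1)"
  using w_0[of 1] w_a[of 1] k3 by auto

lemma hub_of_paths:
  assumes "x \<in> hub_index"
  shows "hub_of r w x \<in> paths_on r G" "u \<in> verts (hub_of r w x)" "v \<notin> verts (hub_of r w x)"
proof -
  obtain i \<alpha> j where x: "x = (i, \<alpha>, j)"
    by (cases x)
  note I = hub_indexD[OF assms[unfolded x]]
  show "hub_of r w x \<in> paths_on r G"
    using I unfolding x hub_of_def prod.case by (intro hub_in_paths) auto
  show "u \<in> verts (hub_of r w x)" "v \<notin> verts (hub_of r w x)"
    using mem_hub_of[OF assms[unfolded x], of 1 0] mem_hub_of[OF assms[unfolded x], of 1 "a 1"] I a1 k3
    by (auto simp: x u_eq v_eq)
qed

lemma bridge_of_paths: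
  assumes "x \<in> bridge_index"
  shows "bridge_of a r w x \<in> paths_on r G" "u \<in> verts (bridge_of a r w x)" "v \<in> verts (bridge_of a r w x)"
proof -
  obtain i \<alpha> j where x: "x = (i, \<alpha>, j)"
    by (cases x)
  note I = bridge_indexD[OF assms[unfolded x]]
  show "bridge_of a r w x \<in> paths_on r G"
    using I unfolding x bridge_of_def prod.case by (intro bridge_in_paths) auto
  show "u \<in> verts (bridge_of a r w x)" "v \<in> verts (bridge_of a r w x)"
    using mem_bridge_of[OF assms[unfolded x], of 1 0] mem_bridge_of[OF assms[unfolded x], of 1 "a 1"] I a1 k3
    by (auto simp: x u_eq v_eq)
qed

lemma hub_path_swap:
  assumes "1 \<le> i" "i \<le> k" "1 \<le> j" "j \<le> k"
  shows "hub_path w i \<alpha> j \<beta> = hub_path w j \<beta> i \<alpha>"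
proof -
  have "rev (hub_list w i \<alpha> j \<beta>) = hub_list w j \<beta> i \<alpha>"
    using w_0[of i] w_0[of j] assms by (simp add: hub_list_def upt_conv_Cons del: upt_Suc)
  then show ?thesis
    by (metis hub_path_def walk_graph_rev)
qed

lemma seg_path_0: "seg_path r w i 0 = hub_path w c 0 i (r - 1)"
  using r3 by (simp add: seg_path_def hub_path_def hub_list_def)

lemma hub_path_eq_bridge: "hub_path w i \<alpha> 1 (a 1) = bridge_path a w i \<alpha> j 0"
  by (simp add: hub_path_def hub_list_def bridge_path_def bridge_list_def)

lemma paths_u_only:
  assumes "P \<in> paths_on r G" "u \<in> verts P" "v \<notin> verts P"
  shows "P \<in> hub_of r w ` hub_index"
  using assms(1)
proof (cases rule: path_cases)
  case (seg i s)
  have "s = 0"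
    using mem_seg[of i s 1 0] seg assms(2) k3 a1 by (auto simp: u_eq)
  moreover have "s + r \<noteq> Suc (a i)"
    using mem_seg[of i s i "a i"] seg assms(3) w_a[of i] by auto
  ultimately have "((if i = 1 then 2 else 1), 0, i) \<in> hub_index"
    using seg k3 a1 a_ge(1)[of 2] r3 by (auto simp: hub_index_def)
  moreover have "P = hub_of r w ((if i = 1 then 2 else 1), 0, i)"
    using seg(4) \<open>s = 0\<close> seg_path_0[of i "if i = 1 then 2 else 1"] by (simp only: hub_of_def prod.case) simp
  ultimately show ?thesis
    by blast
next
  case (hub_u i \<alpha> j \<beta>)
  have "\<alpha> \<noteq> a i" "\<beta> \<noteq> a j"
    using mem_hub[of i j 1 "a 1" \<alpha> \<beta>] hub_u assms(3) k3 by (auto simp: v_eq)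
  then have "(i, \<alpha>, j) \<in> hub_index \<or> (j, \<beta>, i) \<in> hub_index"
    using hub_u by (auto simp: hub_index_def)
  moreover have "P = hub_of r w (i, \<alpha>, j)" "P = hub_of r w (j, \<beta>, i)"
    using hub_u hub_path_swap[of i j \<alpha> \<beta>] by (auto simp: hub_of_def)
  ultimately show ?thesis
    by blast
next
  case (hub_v i \<alpha> j \<beta>)
  then show ?thesis
    using mem_hub_flip[of i j 1 "a 1" \<alpha> \<beta>] assms(3) k3 by (auto simp: v_eq)
next
  case (bridge i \<alpha> j \<beta>)
  then show ?thesis
    using mem_bridge[of i j 1 "a 1" \<alpha> \<beta>] assms(3) k3 a_ge(3)[of i] a_ge(3)[of j] by (auto simp: v_eq)
qed

lemma paths_both:
  assumes "P \<in> paths_on r G" "u \<in> verts P" "v \<in> verts P"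
  shows "P \<in> bridge_of a r w ` bridge_index"
  using assms(1)
proof (cases rule: path_cases)
  case (seg i s)
  have "s = 0"
    using mem_seg[of i s 1 0] seg assms(2) k3 a1 by (auto simp: u_eq)
  moreover have "s + r = Suc (a i)"
    using mem_seg[of i s i "a i"] seg assms(3) w_a[of i] r3 by auto
  \<comment> \<open>A segment with both hubs is a whole strand with \<open>r - 1\<close> edges, and
    only the first strand can be that short.\<close>
  ultimately have "i = 1" "r = Suc (a 1)"
    using a_ge(3)[of i] seg by (cases "i = 1"; force)+
  then have "(2, 0, 2) \<in> bridge_index" "P = bridge_of a r w (2, 0, 2)"
    unfolding bridge_index_def bridge_of_def using seg \<open>s = 0\<close> k3
    by (auto simp: bridge_path_def bridge_list_def seg_path_def)
  then show ?thesis
    by blast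
next
  case (hub_u i \<alpha> j \<beta>)
  \<comment> \<open>A hub path that reaches the other hub runs along the whole first strand, so it
    is a bridge with one empty arm.\<close>
  have *: "P \<in> bridge_of a r w ` bridge_index"
    if "1 \<le> i" "i \<le> k" "i \<noteq> 1" "1 \<le> \<alpha>" "\<alpha> + a 1 + 1 = r" "P = hub_path w i \<alpha> 1 (a 1)" for i \<alpha>
  proof -
    have "(i, \<alpha>, 2) \<in> bridge_index" "P = bridge_of a r w (i, \<alpha>, 2)"
      using that k3 hub_path_eq_bridge[of i \<alpha> 2] by (auto simp: bridge_index_def bridge_of_def)
    then show ?thesis
      by blast
  qed
  have "\<alpha> = a i \<or> \<beta> = a j"
    using mem_hub[of i j 1 "a 1" \<alpha> \<beta>] hub_u assms(3) k3 a1 by (auto simp: v_eq)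
  then show ?thesis
  proof
    assume "\<alpha> = a i"
    then have "i = 1"
      using a_ge(3)[of i] hub_u by force
    then show ?thesis
      using *[of j \<beta>] hub_u hub_path_swap[of i j \<alpha> \<beta>] \<open>\<alpha> = a i\<close> by auto
  next
    assume "\<beta> = a j"
    then have "j = 1"
      using a_ge(3)[of j] hub_u by force
    then show ?thesis
      using *[of i \<alpha>] hub_u \<open>\<beta> = a j\<close> by auto
  qed
next
  case (hub_v i \<alpha> j \<beta>)
  have *: "P \<in> bridge_of a r w ` bridge_index"
    if "1 \<le> i" "i \<le> k" "i \<noteq> 1" "1 \<le> \<alpha>" "\<alpha> + a 1 + 1 = r" "P = hub_path w' i \<alpha> 1 (a 1)" for i \<alpha>
  proof -
    have "(2, 0, i) \<in> bridge_index" "P = bridge_of a r w (2, 0, i)"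
      using that k3 theta.hub_path_eq_bridge[OF reversed, of i \<alpha> 2] bridge_flip[of i \<alpha> 2 0]
      by (auto simp: bridge_index_def bridge_of_def)
    then show ?thesis
      by blast
  qed
  have "\<alpha> = a i \<or> \<beta> = a j"
    using mem_hub_flip[of i j 1 0 \<alpha> \<beta>] hub_v assms(2) k3 a1 by (auto simp: u_eq)
  then show ?thesis
  proof
    assume "\<alpha> = a i"
    then have "i = 1"
      using a_ge(3)[of i] hub_v by force
    then show ?thesis
      using *[of j \<beta>] hub_v theta.hub_path_swap[OF reversed, of i j \<alpha> \<beta>] \<open>\<alpha> = a i\<close> by auto
  next
    assume "\<beta> = a j"
    then have "j = 1"
      using a_ge(3)[of j] hub_v by force
    then show ?thesis
      using *[of i \<alpha>] hub_v \<open>\<beta> = a j\<close> by auto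
  qed
next
  case (bridge i \<alpha> j \<beta>)
  then have "(i, \<alpha>, j) \<in> bridge_index" "P = bridge_of a r w (i, \<alpha>, j)"
    by (auto simp: bridge_index_def bridge_of_def)
  then show ?thesis
    by blast
qed

text \<open>The tip of the arm on \<open>j\<close>, which is nonempty, must lie on an arm of the
  other triple. The crossed match \<open>j = i'\<close>, \<open>j' = i\<close> contradicts the order
  of the strands; the direct match makes the lengths equal.\<close>

lemma inj_hub_of: "inj_on (hub_of r w) hub_index"
proof (rule inj_onI)
  fix x x' assume X: "x \<in> hub_index" "x' \<in> hub_index" "hub_of r w x = hub_of r w x'"
  obtain i \<alpha> j i' \<alpha>' j' where x: "x = (i, \<alpha>, j)" "x' = (i', \<alpha>', j')"
    by (cases x; cases x')
  note I = hub_indexD[OF X(1)[unfolded x]] hub_indexD[OF X(2)[unfolded x]]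
  have arms: "n \<le> 0 \<or> (l = i \<and> n \<le> \<alpha>) \<or> (l = j \<and> n \<le> r - 1 - \<alpha>) \<longleftrightarrow>
      n \<le> 0 \<or> (l = i' \<and> n \<le> \<alpha>') \<or> (l = j' \<and> n \<le> r - 1 - \<alpha>')" if "1 \<le> l" "l \<le> k" "n \<le> a l" for l n
    using mem_hub_of[OF X(1)[unfolded x] that] mem_hub_of[OF X(2)[unfolded x] that] X(3) by (auto simp: x)
  have order: "i < j" if "1 \<le> \<alpha>"
    using X(1) that by (auto simp: x hub_index_def split: if_splits)
  have order': "i' < j'" if "1 \<le> \<alpha>'"
    using X(2) that by (auto simp: x hub_index_def split: if_splits)
  have j: "(j = i' \<and> r - 1 - \<alpha> \<le> \<alpha>') \<or> (j = j' \<and> r - 1 - \<alpha> \<le> r - 1 - \<alpha>')"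
    using arms[of j "r - 1 - \<alpha>"] I(3,4,5,7) by auto
  have j': "(j' = i \<and> r - 1 - \<alpha>' \<le> \<alpha>) \<or> (j' = j \<and> r - 1 - \<alpha>' \<le> r - 1 - \<alpha>)"
    using arms[of j' "r - 1 - \<alpha>'"] I(11,12,13,15) by auto
  have "j = j'"
  proof (rule ccontr)
    assume "j \<noteq> j'"
    then have "j = i'" "j' = i" "1 \<le> \<alpha>" "1 \<le> \<alpha>'"
      using j j' I(5,13) by auto
    then show False
      using order order' by simp
  qed
  moreover have "\<alpha> = \<alpha>'"
    using j j' I(5,8,13,16) \<open>j = j'\<close> by auto
  moreover have "i = i'"
  proof (cases "\<alpha> = 0")
    case True
    then show ?thesis
      using X(1,2) \<open>j = j'\<close> \<open>\<alpha> = \<alpha>'\<close> by (simp add: x hub_index_def)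
  next
    case False
    then show ?thesis
      using arms[of i \<alpha>] I(1,2,6,8) \<open>j = j'\<close> by auto
  qed
  ultimately show "x = x'"
    by (simp add: x)
qed

lemma inj_bridge_of: "inj_on (bridge_of a r w) bridge_index"
proof (rule inj_onI)
  fix x x' assume X: "x \<in> bridge_index" "x' \<in> bridge_index" "bridge_of a r w x = bridge_of a r w x'"
  obtain i \<alpha> j i' \<alpha>' j' where x: "x = (i, \<alpha>, j)" "x' = (i', \<alpha>', j')"
    by (cases x; cases x')
  note I = bridge_indexD[OF X(1)[unfolded x]] bridge_indexD[OF X(2)[unfolded x]]
  define m where "m = r - 1 - a 1"
  have m: "\<alpha> \<le> m" "\<alpha>' \<le> m"
    using I(5,14) by (simp_all add: m_def)
  \<comment> \<open>Arms starting at opposite ends stay in opposite halves of a strand, so even for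
    \<open>i = j\<close> a tip of one is never taken for a vertex of the other.\<close>
  have m_less: "2 * m < a l" if "2 \<le> l" "l \<le> k" for l
    using a_sum[OF that] a_ge(1)[of l] that by (simp add: m_def)
  have arms: "n = 0 \<or> n = a l \<or> l = 1 \<or> (l = i \<and> n \<le> \<alpha>) \<or> (l = j \<and> a l - n \<le> m - \<alpha>) \<longleftrightarrow>
      n = 0 \<or> n = a l \<or> l = 1 \<or> (l = i' \<and> n \<le> \<alpha>') \<or> (l = j' \<and> a l - n \<le> m - \<alpha>')"
    if "1 \<le> l" "l \<le> k" "n \<le> a l" for l n
    using mem_bridge_of[OF X(1)[unfolded x] that] mem_bridge_of[OF X(2)[unfolded x] that] X(3)
    by (auto simp: x m_def)
  have le: "i = i' \<and> \<alpha> \<le> \<alpha>'" if "1 \<le> \<alpha>"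
    using arms[of i \<alpha>] that I(1,2,6,8) m m_less[of i] by auto
  have ge: "i = i' \<and> \<alpha>' \<le> \<alpha>" if "1 \<le> \<alpha>'"
    using arms[of i' \<alpha>'] that I(10,11,15,17) m m_less[of i'] by auto
  have "\<alpha> = \<alpha>'"
    using le ge by (cases "1 \<le> \<alpha>"; cases "1 \<le> \<alpha>'") auto
  moreover have "i = i'"
    using le X(1,2) \<open>\<alpha> = \<alpha>'\<close> by (cases "1 \<le> \<alpha>") (auto simp: x bridge_index_def)
  moreover have "j = j'"
  proof (cases "\<alpha> = m")
    case True
    then show ?thesis
      using X(1,2) \<open>\<alpha> = \<alpha>'\<close> I(5) by (auto simp: x m_def bridge_index_def)
  next
    case False
    define d where "d = m - \<alpha>"
    have "1 \<le> d" "d < a j" "a j - d > \<alpha>"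
      using False m m_less[of j] I(3,4) by (auto simp: d_def)
    then show ?thesis
      using arms[of j "a j - d", folded d_def \<open>\<alpha> = \<alpha>'\<close>, folded d_def] I(3,4,9) by auto
  qed
  ultimately show "x = x'"
    by (simp add: x)
qed

lemma finite_index: "finite hub_index" "finite bridge_index"
  by (rule finite_subset[of _ "{..k} \<times> {..r} \<times> {..k}"]; auto simp: hub_index_def bridge_index_def)+

lemma full_star_u:
  "full_star (paths_on r G) u = hub_of r w ` hub_index \<union> bridge_of a r w ` bridge_index"
  using paths_u_only paths_both hub_of_paths bridge_of_paths unfolding full_star_def by blast

section \<open>The size of a hub star\<close>

lemma card_hub_index_short:
  assumes "r \<le> a 1"
  shows "card hub_index = k + (k choose 2) * (r - 2)"
proof -
  let ?A = "(\<lambda>j. (if j = 1 then 2 else 1, 0, j)) ` {1..k}"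
  let ?B = "(\<lambda>((i, j), \<alpha>). (i, \<alpha>, j)) ` ({(i, j). 1 \<le> i \<and> i < j \<and> j \<le> k} \<times> {1..r - 2})"
  have ra: "r \<le> a l" if "1 \<le> l" "l \<le> k" for l
    using a_mono[of 1 l] that assms by auto
  have "hub_index = ?A \<union> ?B"
  proof (intro equalityI subsetI)
    fix x assume "x \<in> hub_index"
    moreover obtain i \<alpha> j where "x = (i, \<alpha>, j)"
      by (cases x)
    ultimately show "x \<in> ?A \<union> ?B"
      by (cases "\<alpha> = 0") (auto simp: hub_index_def image_iff Bex_def)
  next
    fix x assume "x \<in> ?A \<union> ?B"
    moreover have "\<alpha> < a l" if "1 \<le> l" "l \<le> k" "\<alpha> < r" for l \<alpha>
      using ra[OF that(1,2)] that by simp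
    ultimately show "x \<in> hub_index"
      using k3 r3 by (auto simp: hub_index_def)
  qed
  moreover have "card ?A = k"
    by (subst card_image) (auto simp: inj_on_def)
  moreover have "card ?B = (k choose 2) * (r - 2)"
    using card_ordered_pairs(2)[of 1 k] by (subst card_image) (auto simp: inj_on_def card_cartesian_product)
  moreover have "finite ?B"
    using card_ordered_pairs(1)[of 1 k] by simp
  moreover have "?A \<inter> ?B = {}"
    by auto
  ultimately show ?thesis
    by (simp add: card_Un_disjoint del: One_nat_def)
qed

text \<open>The first strand is too short to carry a one-arm path that avoids \<open>v\<close>. The
  one-arm paths on the other strands are the case \<open>\<alpha> = 0\<close> of \<open>?A\<close>,
  and \<open>?B\<close> collects the paths with two nonempty arms away from the first
  strand.\<close>

lemma card_hub_index_long:
  assumes "a 1 < r"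
  shows "card hub_index = a 1 * (k - 1) + ((k - 1) choose 2) * (r - 2)"
proof -
  let ?A = "(\<lambda>(\<alpha>, j). (1, \<alpha>, j)) ` ({..<a 1} \<times> {2..k})"
  let ?B = "(\<lambda>((i, j), \<alpha>). (i, \<alpha>, j)) ` ({(i, j). 2 \<le> i \<and> i < j \<and> j \<le> k} \<times> {1..r - 2})"
  have ra: "\<alpha> < a l" if "2 \<le> l" "l \<le> k" "\<alpha> < r" for l \<alpha>
    using a_ge(3)[of l] that by auto
  have "hub_index = ?A \<union> ?B"
  proof (intro equalityI subsetI)
    fix x assume x: "x \<in> hub_index"
    obtain i \<alpha> j where eq: "x = (i, \<alpha>, j)"
      by (cases x)
    have "j \<noteq> 1"
      using x assms by (auto simp: hub_index_def eq split: if_splits)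
    then show "x \<in> ?A \<union> ?B"
      using x by (cases "i = 1") (auto simp: eq hub_index_def image_iff Bex_def split: if_splits)
  next
    fix x assume "x \<in> ?A \<union> ?B"
    then show "x \<in> hub_index"
      using k3 r3 assms ra a1 by (auto simp: hub_index_def)
  qed
  moreover have "card ?A = a 1 * (k - 1)"
    by (subst card_image) (auto simp: inj_on_def card_cartesian_product)
  moreover have "card ?B = ((k - 1) choose 2) * (r - 2)"
    using card_ordered_pairs(2)[of 2 k] k3
    by (subst card_image) (auto simp: inj_on_def card_cartesian_product numeral_2_eq_2)
  moreover have "finite ?B"
    using card_ordered_pairs(1)[of 2 k] k3 by simp
  moreover have "?A \<inter> ?B = {}"
    by auto
  ultimately show ?thesis
    by (simp add: card_Un_disjoint del: One_nat_def)
qed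

lemma card_bridge_index:
  "card bridge_index = (if r \<le> a 1 then 0 else if r = a 1 + 1 then 1
    else (r - a 1 - 2) * (k - 1)\<^sup>2 + 2 * (k - 1))"
proof -
  consider "r \<le> a 1" | "r = a 1 + 1" | "a 1 + 2 \<le> r"
    by linarith
  then show ?thesis
  proof cases
    case 1
    then have "bridge_index = {}"
      by (auto simp: bridge_index_def)
    with 1 show ?thesis
      by simp
  next
    case 2
    then have "bridge_index = {(2, 0, 2)}"
      unfolding bridge_index_def using 2 k3 by auto
    with 2 show ?thesis
      by simp
  next
    case 3
    \<comment> \<open>\<open>?A\<close> has an empty arm at \<open>u\<close>, \<open>?B\<close> an
      empty arm at \<open>v\<close>, and \<open>?C\<close> has none.\<close>
    let ?A = "{2 :: nat} \<times> {0 :: nat} \<times> {2..k}"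
    let ?B = "{2..k} \<times> {r - a 1 - 1} \<times> {2 :: nat}"
    let ?C = "{2..k} \<times> {1..r - a 1 - 2} \<times> {2..k}"
    have "bridge_index = ?A \<union> (?B \<union> ?C)"
      using 3 k3 by (auto simp: bridge_index_def)
    moreover have "?A \<inter> (?B \<union> ?C) = {}" "?B \<inter> ?C = {}"
      using 3 by auto
    moreover have "finite ?A" "finite ?B" "finite ?C"
      by auto
    ultimately have "card bridge_index = card ?A + (card ?B + card ?C)"
      by (simp only: card_Un_disjoint finite_Un simp_thms)
    with 3 show ?thesis
      by (simp add: card_cartesian_product power2_eq_square)
  qed
qed

text \<open>The first formula persists for \<open>r = a 1 + 1\<close> because the only change is
  that the one-arm path on the first strand now ends in \<open>v\<close> and is counted as the
  single bridge.\<close>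

lemma card_index: "card hub_index + card bridge_index = theta_bound k (a 1) r"
proof -
  obtain n where n: "k = Suc n"
    using k3 by (cases k) auto
  consider "r \<le> a 1" | "r = a 1 + 1" | "a 1 + 2 \<le> r"
    by linarith
  then show ?thesis
  proof cases
    case 1
    then show ?thesis
      by (simp add: card_hub_index_short card_bridge_index theta_bound_def)
  next
    case 2
    moreover have "Suc n choose 2 = (n choose 2) + n"
      by (simp add: numeral_2_eq_2)
    moreover obtain m where "a 1 = Suc m"
      using a1 by (cases "a 1") auto
    moreover have "card hub_index + card bridge_index
      = a 1 * (k - 1) + ((k - 1) choose 2) * (r - 2) + 1"
      using 2 card_hub_index_long card_bridge_index by simp
    ultimately show ?thesis
      by (simp add: n theta_bound_def algebra_simps)
  next
    case 3
    then have "card hub_index + card bridge_index = a 1 * (k - 1) + ((k - 1) choose 2) * (r - 2)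
      + ((r - a 1 - 2) * (k - 1)\<^sup>2 + 2 * (k - 1))"
      using card_hub_index_long card_bridge_index by simp
    with 3 show ?thesis
      by (simp add: theta_bound_def add_mult_distrib)
  qed
qed

lemma card_full_star_u: "card (full_star (paths_on r G) u) = theta_bound k (a 1) r"
proof -
  have "hub_of r w ` hub_index \<inter> bridge_of a r w ` bridge_index = {}"
    using hub_of_paths(3) bridge_of_paths(3) by (metis (no_types, lifting) disjoint_iff imageE)
  then show ?thesis
    unfolding full_star_u card_index[symmetric]
    by (simp add: card_Un_disjoint finite_index card_image inj_hub_of inj_bridge_of)
qed

section \<open>Families in which every path contains a hub\<close>

text \<open>The last position reached on strand \<open>l\<close>, with 0 where only the hub is met.
  Membership in a hub path becomes one inequality per strand.\<close>

definition arm :: "nat \<times> nat \<times> nat \<Rightarrow> nat \<Rightarrow> nat" where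
  "arm = (\<lambda>(i, \<alpha>, j) l. if l = j then r - 1 - \<alpha> else if l = i then \<alpha> else 0)"

lemma mem_hub_of_arm:
  assumes "x \<in> hub_index" "1 \<le> l" "l \<le> k" "n \<le> a l"
  shows "w l n \<in> verts (hub_of r w x) \<longleftrightarrow> n \<le> arm x l"
proof -
  obtain i \<alpha> j where x: "x = (i, \<alpha>, j)"
    by (cases x)
  show ?thesis
    using mem_hub_of[OF assms[unfolded x]] hub_indexD(8)[OF assms(1)[unfolded x]]
    by (auto simp: x arm_def)
qed

lemma mem_hub_of_flip_arm:
  assumes "x \<in> hub_index" "1 \<le> l" "l \<le> k" "n \<le> a l"
  shows "w l n \<in> verts (hub_of r w' x) \<longleftrightarrow> a l - n \<le> arm x l"
  using theta.mem_hub_of_arm[OF reversed assms(1-3), of "a l - n"] assms(4)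
  by (simp add: w_conv_flip[symmetric])

lemma paths_coord:
  assumes "P \<in> paths_on r G" "y \<in> verts P"
  obtains l n where "1 \<le> l" "l \<le> k" "n \<le> a l" "y = w l n"
proof -
  have "y \<in> verts G"
    using assms by (auto simp: paths_on_def subgraph_def)
  then show thesis
    using that by (auto simp: verts_G)
qed

text \<open>On strand \<open>l\<close> the path at \<open>u\<close> covers positions up to
  \<open>arm x l\<close>, the path at \<open>v\<close> those from \<open>a l - arm x' l\<close>
  on.\<close>

lemma hub_of_disjoint:
  assumes "x \<in> hub_index" "x' \<in> hub_index"
    and arms: "\<And>l. 1 \<le> l \<Longrightarrow> l \<le> k \<Longrightarrow> arm x l + arm x' l < a l"
  shows "verts (hub_of r w x) \<inter> verts (hub_of r w' x') = {}"
proof (rule ccontr)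
  assume "verts (hub_of r w x) \<inter> verts (hub_of r w' x') \<noteq> {}"
  then obtain y where y: "y \<in> verts (hub_of r w x)" "y \<in> verts (hub_of r w' x')"
    by blast
  obtain l n where l: "1 \<le> l" "l \<le> k" "n \<le> a l" "y = w l n"
    using paths_coord[OF hub_of_paths(1)[OF assms(1)] y(1)] by blast
  then show False
    using mem_hub_of_arm[OF assms(1) l(1-3)] mem_hub_of_flip_arm[OF assms(2) l(1-3)] arms[OF l(1,2)] y
    by simp
qed

lemma not_both:
  assumes "intersecting F" "x \<in> hub_index" "x' \<in> hub_index"
    and "\<And>l. 1 \<le> l \<Longrightarrow> l \<le> k \<Longrightarrow> arm x l + arm x' l < a l"
  shows "\<not> (hub_of r w x \<in> F \<and> hub_of r w' x' \<in> F)"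
  using hub_of_disjoint[OF assms(2-4)] assms(1) by (auto simp: intersecting_def)

lemma hub_family_decomp:
  assumes "F \<subseteq> paths_on r G" "\<forall>P\<in>F. u \<in> verts P \<or> v \<in> verts P"
  shows "F \<subseteq> hub_of r w ` hub_index \<union> hub_of r w' ` hub_index \<union> bridge_of a r w ` bridge_index"
proof
  fix P assume "P \<in> F"
  then show "P \<in> hub_of r w ` hub_index \<union> hub_of r w' ` hub_index \<union> bridge_of a r w ` bridge_index"
    using assms paths_u_only[of P] theta.paths_u_only[OF reversed, of P] paths_both[of P] by blast
qed

text \<open>This reduces the bound to finding a permutation of the triples that pairs each path at
  \<open>u\<close> with a disjoint path at \<open>v\<close>. Paths through both hubs belong to both
  stars and need no partner.\<close>

lemma hub_bound:
  assumes F: "F \<subseteq> paths_on r G" "\<forall>P\<in>F. u \<in> verts P \<or> v \<in> verts P" "intersecting F"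
    and \<phi>: "inj_on \<phi> hub_index" "\<phi> ` hub_index \<subseteq> hub_index"
      "\<forall>x\<in>hub_index. \<forall>l\<in>{1..k}. arm x l + arm (\<phi> x) l < a l"
  shows "card F \<le> theta_bound k (a 1) r"
    and "card F = theta_bound k (a 1) r \<Longrightarrow> x \<in> hub_index \<Longrightarrow>
      hub_of r w x \<in> F \<or> hub_of r w' (\<phi> x) \<in> F"
proof -
  have fin: "finite (bridge_of a r w ` bridge_index)"
    using finite_index by simp
  have pair: "hub_of r w' (\<phi> x) \<notin> F" if "x \<in> hub_index" "hub_of r w x \<in> F" for x
    using not_both[OF F(3) that(1), of "\<phi> x"] \<phi>(2,3) that by fastforce
  have eq: "theta_bound k (a 1) r = card hub_index + card (bridge_of a r w ` bridge_index)"
    using card_index by (simp add: card_image inj_bridge_of)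
  note * = card_le_by_pairing[OF finite_index(1) \<phi>(1,2) fin hub_family_decomp[OF F(1,2)]]
  show "card F \<le> theta_bound k (a 1) r"
    unfolding eq using pair by (rule *(1))
  show "hub_of r w x \<in> F \<or> hub_of r w' (\<phi> x) \<in> F"
    if "card F = theta_bound k (a 1) r" "x \<in> hub_index"
    using *(2)[OF pair _ that(2)] that(1) unfolding eq by blast
qed

lemma subset_full_star_u:
  assumes "F \<subseteq> paths_on r G" "\<forall>P\<in>F. u \<in> verts P \<or> v \<in> verts P"
    and "\<And>x. x \<in> hub_index \<Longrightarrow> hub_of r w' x \<notin> F"
  shows "F \<subseteq> full_star (paths_on r G) u"
proof
  fix P assume P: "P \<in> F"
  then have "P \<notin> hub_of r w' ` hub_index"
    using assms(3) by blast
  then have "u \<in> verts P"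
    using P assms(1,2) theta.paths_u_only[OF reversed, of P] by blast
  then show "P \<in> full_star (paths_on r G) u"
    using P assms(1) by (auto simp: full_star_def)
qed

definition single :: "nat \<Rightarrow> nat \<times> nat \<times> nat" where
  "single j = (if j = 1 then 2 else 1, 0, j)"

lemma arm_single: "arm (single j) l = (if l = j then r - 1 else 0)"
  by (auto simp: arm_def single_def)

lemma arm_less: "x \<in> hub_index \<Longrightarrow> 1 \<le> l \<Longrightarrow> l \<le> k \<Longrightarrow> arm x l < a l"
  using a_ge(1)[of l] by (cases x) (auto simp: arm_def dest: hub_indexD)

lemma single_in_index: "1 \<le> j \<Longrightarrow> j \<le> k \<Longrightarrow> r \<le> a j \<Longrightarrow> single j \<in> hub_index"
  using r3 k3 a1 a_ge(1)[of 2] by (auto simp: single_def hub_index_def)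

text \<open>A path at \<open>v\<close> without edges on strand \<open>j\<close> meets that strand in
  \<open>v\<close> only, and the arm of \<open>r - 1 < a j\<close> edges from \<open>u\<close> stops
  before it.\<close>

lemma single_blocks:
  assumes "intersecting F" "x \<in> hub_index" "1 \<le> j" "j \<le> k" "r \<le> a j"
    and "hub_of r w (single j) \<in> F" "arm x j = 0"
  shows "hub_of r w' x \<notin> F"
proof -
  have "arm (single j) l + arm x l < a l" if "1 \<le> l" "l \<le> k" for l
    using that assms(5,7) arm_less[OF assms(2) that] r3 by (auto simp: arm_single)
  then show ?thesis
    using not_both[OF assms(1) single_in_index[OF assms(3-5)] assms(2)] assms(6) by blast
qed

lemma short_equality:
  assumes F: "F \<subseteq> paths_on r G" "\<forall>P\<in>F. u \<in> verts P \<or> v \<in> verts P" "intersecting F"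
    and "r \<le> a 1" "\<And>j. 1 \<le> j \<Longrightarrow> j \<le> k \<Longrightarrow> hub_of r w (single j) \<in> F"
  shows "F \<subseteq> full_star (paths_on r G) u"
  using F(1,2)
proof (rule subset_full_star_u)
  fix x assume x: "x \<in> hub_index"
  obtain i \<alpha> j where eq: "x = (i, \<alpha>, j)"
    by (cases x)
  \<comment> \<open>A path uses at most two strands, so one of three is left for a one-arm path at
    \<open>u\<close> that blocks it.\<close>
  have "\<exists>l\<in>{1, 2, 3}. l \<noteq> i \<and> l \<noteq> j"
    by auto
  then obtain l where "l \<in> {1, 2, 3}" "l \<noteq> i" "l \<noteq> j"
    by blast
  moreover from this have "1 \<le> l" "l \<le> k"
    using k3 by auto
  ultimately show "hub_of r w' x \<notin> F"
    using x F(3) assms(4,5) a_mono[of 1 l] by (intro single_blocks[of F x l]) (auto simp: eq arm_def)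
qed

lemma hub_case_short:
  assumes F: "F \<subseteq> paths_on r G" "\<forall>P\<in>F. u \<in> verts P \<or> v \<in> verts P" "intersecting F"
    and r: "r \<le> a 1"
  shows "card F \<le> theta_bound k (a 1) r"
    and "card F = theta_bound k (a 1) r \<Longrightarrow>
      F \<subseteq> full_star (paths_on r G) u \<or> F \<subseteq> full_star (paths_on r G) v"
proof -
  \<comment> \<open>Two arms exchange their lengths, which add up to \<open>r - 1 < a l\<close> on
    each strand. Two one-arm paths on the same strand could meet, as \<open>2 * (r - 1)\<close> may
    reach \<open>a j\<close>; hence the cyclic shift.\<close>
  define \<sigma> where "\<sigma> j = (if j = k then 1 else Suc j)" for j
  define \<phi> :: "nat \<times> nat \<times> nat \<Rightarrow> nat \<times> nat \<times> nat" where
    "\<phi> = (\<lambda>(i, \<alpha>, j). if \<alpha> = 0 then single (\<sigma> j) else (i, r - 1 - \<alpha>, j))"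
  have ra: "r \<le> a l" if "1 \<le> l" "l \<le> k" for l
    using a_mono[of 1 l] that r by auto
  have \<sigma>: "1 \<le> \<sigma> j" "\<sigma> j \<le> k" "\<sigma> j \<noteq> j" if "1 \<le> j" "j \<le> k" for j
    using that k3 by (auto simp: \<sigma>_def)
  have inj: "inj_on \<phi> hub_index"
  proof (rule inj_onI)
    fix x x' assume *: "x \<in> hub_index" "x' \<in> hub_index" "\<phi> x = \<phi> x'"
    obtain i \<alpha> j i' \<alpha>' j' where eq: "x = (i, \<alpha>, j)" "x' = (i', \<alpha>', j')"
      by (cases x; cases x')
    have le: "\<alpha> + 2 \<le> r" "\<alpha>' + 2 \<le> r" "1 \<le> j" "1 \<le> j'" "j \<le> k" "j' \<le> k"
      using hub_indexD[OF *(1)[unfolded eq]] hub_indexD[OF *(2)[unfolded eq]] by auto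
    have "\<sigma> j = \<sigma> j' \<Longrightarrow> j = j'"
      using le(3-6) by (cases "j = k"; cases "j' = k") (simp_all add: \<sigma>_def)
    then have "j = j' \<and> \<alpha> = \<alpha>' \<and> (\<alpha> \<noteq> 0 \<longrightarrow> i = i')"
      using *(3) le(1,2) by (cases "\<alpha> = 0"; cases "\<alpha>' = 0") (auto simp: eq \<phi>_def single_def)
    then show "x = x'"
      using *(1,2) by (cases "\<alpha> = 0") (simp_all add: eq hub_index_def)
  qed
  have closed: "\<phi> ` hub_index \<subseteq> hub_index"
  proof (rule image_subsetI)
    fix x assume that: "x \<in> hub_index"
    obtain i \<alpha> j where eq: "x = (i, \<alpha>, j)"
      by (cases x)
    note I = hub_indexD[OF that[unfolded eq]]
    show "\<phi> x \<in> hub_index"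
    proof (cases "\<alpha> = 0")
      case True
      then show ?thesis
        using I \<sigma>[of j] ra[of "\<sigma> j"] by (auto simp: eq \<phi>_def intro!: single_in_index)
    next
      case False
      then show ?thesis
        using that ra[of i] ra[of j] I by (auto simp: eq \<phi>_def hub_index_def)
    qed
  qed
  have arms: "\<forall>x\<in>hub_index. \<forall>l\<in>{1..k}. arm x l + arm (\<phi> x) l < a l"
  proof (intro ballI)
    fix x l assume "x \<in> hub_index" "l \<in> {1..k}"
    then have that: "x \<in> hub_index" "1 \<le> l" "l \<le> k"
      by auto
    obtain i \<alpha> j where eq: "x = (i, \<alpha>, j)"
      by (cases x)
    note I = hub_indexD[OF that(1)[unfolded eq]]
    show "arm x l + arm (\<phi> x) l < a l"
      using \<sigma>[of j] ra[OF that(2,3)] I r3 by (auto simp: eq \<phi>_def arm_single) (auto simp: arm_def)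
  qed
  note bound = hub_bound[OF F inj closed arms]
  show "card F \<le> theta_bound k (a 1) r"
    by (rule bound(1))
  show "F \<subseteq> full_star (paths_on r G) u \<or> F \<subseteq> full_star (paths_on r G) v"
    if card: "card F = theta_bound k (a 1) r"
  proof -
    have single: "hub_of r w (single j) \<in> F \<or> hub_of r w' (single (\<sigma> j)) \<in> F" if "1 \<le> j" "j \<le> k" for j
      using bound(2)[OF card single_in_index[OF that ra[OF that]]]
      by (simp add: \<phi>_def single_def)
    have block: "hub_of r w' (single l) \<notin> F"
      if "hub_of r w (single i) \<in> F" "1 \<le> i" "i \<le> k" "1 \<le> l" "l \<le> k" "i \<noteq> l" for i l
      using single_blocks[OF F(3) single_in_index[OF that(4,5) ra[OF that(4,5)]] that(2,3)
          ra[OF that(2,3)] that(1)]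
        that by (auto simp: arm_single)
    show ?thesis
    proof (cases "\<exists>i. 1 \<le> i \<and> i \<le> k \<and> hub_of r w (single i) \<in> F")
      case True
      then obtain i where i: "1 \<le> i" "i \<le> k" "hub_of r w (single i) \<in> F"
        by blast
      have *: "hub_of r w (single j) \<in> F" if "1 \<le> j" "j \<le> k" "\<sigma> j \<noteq> i" for j
        using single[OF that(1,2)] block[OF i(3,1,2), of "\<sigma> j"] \<sigma>[OF that(1,2)] that(3) by metis
      \<comment> \<open>The one-arm path at \<open>u\<close> on strand \<open>i\<close> need not
        block the one at \<open>v\<close> on the same strand, so a second strand is needed. It is
        \<open>\<sigma> i\<close>: with at least three strands,
        \<open>\<sigma> (\<sigma> i) \<noteq> i\<close>.\<close>
      have "\<exists>j. 1 \<le> j \<and> j \<le> k \<and> j \<noteq> i \<and> \<sigma> j \<noteq> i"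
        using i k3 by (intro exI[of _ "\<sigma> i"]) (auto simp: \<sigma>_def)
      then obtain j where "1 \<le> j" "j \<le> k" "j \<noteq> i" "hub_of r w (single j) \<in> F"
        using * by blast
      then have "hub_of r w' (single i) \<notin> F"
        using block[of j i] i by blast
      then have "hub_of r w (single j) \<in> F" if "1 \<le> j" "j \<le> k" for j
        using *[OF that] single[OF that] by (cases "\<sigma> j = i") auto
      then show ?thesis
        using short_equality[OF F r] by blast
    next
      case False
      have "hub_of r w' (single j) \<in> F" if "1 \<le> j" "j \<le> k" for j
      proof -
        \<comment> \<open>The preimage of \<open>j\<close> under \<open>\<sigma>\<close>, whose path
          at \<open>u\<close> is missing.\<close>
        define i where "i = (if j = 1 then k else j - 1)"
        have "1 \<le> i" "i \<le> k" "\<sigma> i = j"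
          using that k3 by (auto simp: i_def \<sigma>_def)
        then show ?thesis
          using False single[of i] by auto
      qed
      then show ?thesis
        using theta.short_equality[OF reversed F(1) _ F(3) r] F(2)
        unfolding theta.single_def[OF reversed] single_def by blast
    qed
  qed
qed

text \<open>Both arms of the path at \<open>u\<close> are nonempty and avoid the first strand, so
  each has at most \<open>r - 2\<close> edges. The path at \<open>v\<close> takes the longest
  possible arm on the first strand, which leaves \<open>r - a 1\<close> edges on \<open>m\<close>.
  The sum \<open>2 * r - 2 - a 1\<close> is below the length of every strand but the first.\<close>

lemma cross_blocks:
  assumes "intersecting F" "a 1 < r" "(i, \<alpha>, j) \<in> hub_index" "2 \<le> i" "hub_of r w (i, \<alpha>, j) \<in> F"
    and m: "2 \<le> m" "m \<le> k"
  shows "hub_of r w' (1, a 1 - 1, m) \<notin> F"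
proof -
  note I = hub_indexD[OF assms(3)]
  have \<alpha>: "1 \<le> \<alpha>" "2 \<le> j"
    using assms(2-4) by (auto simp: hub_index_def split: if_splits)
  have x: "(1, a 1 - 1, m) \<in> hub_index"
    using m k3 assms(2) a1 a_ge(3)[of m] by (auto simp: hub_index_def)
  have "arm (i, \<alpha>, j) l + arm (1, a 1 - 1, m) l < a l" if "1 \<le> l" "l \<le> k" for l
  proof (cases "l = 1")
    case True
    then show ?thesis
      using \<alpha> assms(4) m a1 by (auto simp: arm_def)
  next
    case False
    have "arm (i, \<alpha>, j) l \<le> r - 2" "arm (1, a 1 - 1, m) l \<le> r - a 1"
      using False \<alpha> I(5) a1 by (auto simp: arm_def)
    then show ?thesis
      using a_sum[of l] False that assms(2) r3 by simp
  qed
  then show ?thesis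
    using not_both[OF assms(1,3) x] assms(5) by blast
qed

text \<open>A path at \<open>v\<close> indexed with \<open>i = 1\<close> uses at most one further
  strand, so a one-arm path at \<open>u\<close> on another long strand blocks it. For
  \<open>k = 3\<close>, a path with two arms off the first strand leaves no such strand free; this
  is why \<open>no_cross\<close> is a premise.\<close>

lemma long_equality:
  assumes F: "F \<subseteq> paths_on r G" "\<forall>P\<in>F. u \<in> verts P \<or> v \<in> verts P" "intersecting F"
    and r: "a 1 < r"
    and single: "\<And>j. 2 \<le> j \<Longrightarrow> j \<le> k \<Longrightarrow> hub_of r w (1, 0, j) \<in> F"
    and no_cross: "\<And>i \<alpha> j. (i, \<alpha>, j) \<in> hub_index \<Longrightarrow> 2 \<le> i \<Longrightarrow> hub_of r w' (i, \<alpha>, j) \<notin> F"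
  shows "F \<subseteq> full_star (paths_on r G) u"
  using F(1,2)
proof (rule subset_full_star_u)
  fix x assume x: "x \<in> hub_index"
  obtain i \<alpha> j where eq: "x = (i, \<alpha>, j)"
    by (cases x)
  show "hub_of r w' x \<notin> F"
  proof (cases "2 \<le> i")
    case True
    then show ?thesis
      using no_cross x eq by blast
  next
    case False
    then have "i = 1"
      using hub_indexD(1)[OF x[unfolded eq]] by simp
    have "\<exists>l. 2 \<le> l \<and> l \<le> k \<and> l \<noteq> j"
      using k3 by (intro exI[of _ "if j = 2 then 3 else 2"]) auto
    then obtain l where "2 \<le> l" "l \<le> k" "l \<noteq> j"
      by blast
    then show ?thesis
      using x F(3) single[of l] a_ge(3)[of l] \<open>i = 1\<close>
      by (intro single_blocks[of F x l]) (auto simp: eq arm_def single_def)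
  qed
qed

lemma hub_case_long:
  assumes F: "F \<subseteq> paths_on r G" "\<forall>P\<in>F. u \<in> verts P \<or> v \<in> verts P" "intersecting F"
    and r: "a 1 < r"
  shows "card F \<le> theta_bound k (a 1) r"
    and "card F = theta_bound k (a 1) r \<Longrightarrow>
      F \<subseteq> full_star (paths_on r G) u \<or> F \<subseteq> full_star (paths_on r G) v"
proof -
  \<comment> \<open>On the first strand the arms \<open>\<alpha>\<close> and
    \<open>a 1 - 1 - \<alpha>\<close> just miss each other. The other two arms total
    \<open>2 * r - 1 - a 1\<close>, which can equal \<open>a 2\<close>, so \<open>\<tau>\<close>
    places them on different strands.\<close>
  define \<tau> where "\<tau> j = (if j = k then 2 else Suc j)" for j
  define \<phi> :: "nat \<times> nat \<times> nat \<Rightarrow> nat \<times> nat \<times> nat" where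
    "\<phi> = (\<lambda>(i, \<alpha>, j). if i = 1 then (1, a 1 - 1 - \<alpha>, \<tau> j) else (i, r - 1 - \<alpha>, j))"
  have \<tau>: "2 \<le> \<tau> j" "\<tau> j \<le> k" "\<tau> j \<noteq> j" if "2 \<le> j" "j \<le> k" for j
    using that k3 by (auto simp: \<tau>_def)
  have X: "1 \<le> i" "i \<le> k" "2 \<le> j" "j \<le> k" "\<alpha> + 2 \<le> r" "i \<noteq> j" "i = 1 \<or> 1 \<le> \<alpha>" "i = 1 \<longrightarrow> \<alpha> < a 1" "i < j"
    if "(i, \<alpha>, j) \<in> hub_index" for i \<alpha> j
    using that r by (auto simp: hub_index_def split: if_splits)
  have ra: "r \<le> a l" if "2 \<le> l" "l \<le> k" for l
    using a_ge(3) that by auto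
  have inj: "inj_on \<phi> hub_index"
  proof (rule inj_onI)
    fix x x' assume *: "x \<in> hub_index" "x' \<in> hub_index" "\<phi> x = \<phi> x'"
    obtain i \<alpha> j i' \<alpha>' j' where eq: "x = (i, \<alpha>, j)" "x' = (i', \<alpha>', j')"
      by (cases x; cases x')
    note I = X[OF *(1)[unfolded eq]] X[OF *(2)[unfolded eq]]
    have "\<tau> j = \<tau> j' \<Longrightarrow> j = j'"
      using I(3,4,12,13) by (cases "j = k"; cases "j' = k") (simp_all add: \<tau>_def)
    then show "x = x'"
      using *(3) I(5,8,14,17) by (cases "i = 1"; cases "i' = 1") (auto simp: eq \<phi>_def)
  qed
  have closed: "\<phi> ` hub_index \<subseteq> hub_index"
  proof (rule image_subsetI)
    fix x assume that: "x \<in> hub_index"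
    obtain i \<alpha> j where eq: "x = (i, \<alpha>, j)"
      by (cases x)
    note I = X[OF that[unfolded eq]]
    show "\<phi> x \<in> hub_index"
      using I \<tau>[of j] ra[of i] ra[of j] ra[of "\<tau> j"] r a1 by (auto simp: eq \<phi>_def hub_index_def)
  qed
  have arms: "\<forall>x\<in>hub_index. \<forall>l\<in>{1..k}. arm x l + arm (\<phi> x) l < a l"
  proof (intro ballI)
    fix x l assume "x \<in> hub_index" "l \<in> {1..k}"
    then have that: "x \<in> hub_index" "1 \<le> l" "l \<le> k"
      by auto
    obtain i \<alpha> j where eq: "x = (i, \<alpha>, j)"
      by (cases x)
    note I = X[OF that(1)[unfolded eq]]
    show "arm x l + arm (\<phi> x) l < a l"
      using \<tau>[of j] ra[of l] I r3 that a1 a_ge(1)[of l] by (auto simp: eq \<phi>_def arm_def)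
  qed
  note bound = hub_bound[OF F inj closed arms]
  show "card F \<le> theta_bound k (a 1) r"
    by (rule bound(1))
  show "F \<subseteq> full_star (paths_on r G) u \<or> F \<subseteq> full_star (paths_on r G) v"
    if card: "card F = theta_bound k (a 1) r"
  proof -
    have pair: "hub_of r w x \<in> F \<or> hub_of r w' (\<phi> x) \<in> F" if "x \<in> hub_index" for x
      using bound(2)[OF card that] .
    have idx: "(1, \<alpha>, j) \<in> hub_index" if "\<alpha> < a 1" "2 \<le> j" "j \<le> k" for \<alpha> j
      using that ra[of j] k3 r by (auto simp: hub_index_def)
    \<comment> \<open>The blocked triple \<open>(1, a 1 - 1, \<tau> l)\<close> is
      \<open>\<phi> (1, 0, l)\<close>, so the partner at \<open>u\<close> is forced into
      \<open>F\<close>.\<close>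
    have single_u: "hub_of r w (1, 0, l) \<in> F"
      if "(i, \<alpha>, j) \<in> hub_index" "2 \<le> i" "hub_of r w (i, \<alpha>, j) \<in> F" "2 \<le> l" "l \<le> k" for i \<alpha> j l
      using cross_blocks[OF F(3) r that(1-3), of "\<tau> l"] \<tau>[OF that(4,5)] pair[OF idx[of 0 l]] that a1
      by (auto simp: \<phi>_def)
    have single_v: "hub_of r w' (1, 0, l) \<in> F"
      if "(i, \<alpha>, j) \<in> hub_index" "2 \<le> i" "hub_of r w' (i, \<alpha>, j) \<in> F" "2 \<le> l" "l \<le> k" for i \<alpha> j l
    proof -
      \<comment> \<open>The blocked path is now at \<open>u\<close>, so the preimage of
        \<open>l\<close> under \<open>\<tau>\<close> is required.\<close>
      define m where "m = (if l = 2 then k else l - 1)"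
      have m: "2 \<le> m" "m \<le> k" "\<tau> m = l"
        using that k3 by (auto simp: m_def \<tau>_def)
      then show ?thesis
        using theta.cross_blocks[OF reversed F(3) r that(1-3) m(1,2)] pair[OF idx[of "a 1 - 1" m]] a1
        by (auto simp: \<phi>_def flip_flip)
    qed
    have clash: "\<not> (hub_of r w (1, 0, 2) \<in> F \<and> hub_of r w' (1, 0, 3) \<in> F)"
    proof -
      have "arm (1, 0, 2) l + arm (1, 0, 3) l < a l" if "1 \<le> l" "l \<le> k" for l
        using that ra[of l] a_ge(1)[of l] r3 k3 by (auto simp: arm_def)
      then show ?thesis
        using not_both[OF F(3) idx[of 0 2] idx[of 0 3]] a1 k3 by auto
    qed
    \<comment> \<open>A path with two nonempty arms off the first strand; its partner at
      \<open>v\<close> is \<open>(2, r - 2, 3)\<close>. Whichever of the two lies in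
      \<open>F\<close> decides the hub.\<close>
    have T: "(2, 1, 3) \<in> hub_index"
      using r3 k3 ra[of 2] ra[of 3] by (auto simp: hub_index_def)
    have cross: "(2, r - 2, 3) \<in> hub_index" "hub_of r w (2, 1, 3) \<in> F \<or> hub_of r w' (2, r - 2, 3) \<in> F"
      using pair[OF T] imageI[OF T, of \<phi>] closed by (auto simp: \<phi>_def numeral_2_eq_2)
    show ?thesis
    proof (cases "hub_of r w (2, 1, 3) \<in> F")
      case True
      have "hub_of r w' (i, \<alpha>, j) \<notin> F" if "(i, \<alpha>, j) \<in> hub_index" "2 \<le> i" for i \<alpha> j
        using single_u[OF T _ True] single_v[OF that] clash k3 by auto
      then show ?thesis
        using long_equality[OF F r single_u[OF T _ True]] by auto
    next
      case False
      then have True: "hub_of r w' (2, r - 2, 3) \<in> F"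
        using cross by blast
      have "hub_of r w (i, \<alpha>, j) \<notin> F" if "(i, \<alpha>, j) \<in> hub_index" "2 \<le> i" for i \<alpha> j
        using single_v[OF cross(1) _ True] single_u[OF that] clash k3 by auto
      then have "F \<subseteq> full_star (paths_on r G) v"
        using single_v[OF cross(1) _ True] F(2)
        by (intro theta.long_equality[OF reversed F(1) _ F(3) r]) (auto simp: flip_flip)
      then show ?thesis ..
    qed
  qed
qed

section \<open>Families with a path inside a strand\<close>

text \<open>The \<open>r\<close>-path that ends at position \<open>\<alpha>\<close> of strand \<open>i\<close> and otherwise runs, away from position
  \<open>\<alpha> + 1\<close>, inside the cycle formed by the strands \<open>i\<close> and \<open>1\<close>.\<close>

definition cycle_path :: "nat \<Rightarrow> nat \<Rightarrow> 'a graph" where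
  "cycle_path i \<alpha> =
    (if r \<le> Suc \<alpha> then seg_path r w i (Suc \<alpha> - r)
     else if r \<le> Suc \<alpha> + a 1 then hub_path w i \<alpha> 1 (r - 1 - \<alpha>)
     else bridge_path a w i \<alpha> i (r - 1 - a 1 - \<alpha>))"

definition left_paths :: "nat \<Rightarrow> nat \<Rightarrow> 'a graph set" where
  "left_paths i \<alpha> = {P \<in> paths_on r G. w i \<alpha> \<in> verts P \<and> w i (Suc \<alpha>) \<notin> verts P}"

text \<open>The arm on strand \<open>i\<close> must end exactly at \<open>\<alpha>\<close>, which
  fixes all lengths and leaves only the strand of the other arm free. Paths hanging from
  \<open>v\<close> are impossible: those that contain \<open>\<alpha>\<close> also contain
  \<open>Suc \<alpha>\<close>.\<close>

lemma left_paths_cases: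
  assumes "P \<in> left_paths i \<alpha>" "1 \<le> i" "i \<le> k" "1 \<le> \<alpha>" "Suc \<alpha> < a i"
  obtains (seg) "r \<le> Suc \<alpha>" "P = seg_path r w i (Suc \<alpha> - r)"
  | (hub) j where "1 \<le> j" "j \<le> k" "j \<noteq> i" "\<alpha> + 2 \<le> r" "r - 1 - \<alpha> \<le> a j" "P = hub_path w i \<alpha> j (r - 1 - \<alpha>)"
  | (bridge) j where "2 \<le> i" "2 \<le> j" "j \<le> k" "\<alpha> + a 1 + 2 \<le> r" "P = bridge_path a w i \<alpha> j (r - 1 - a 1 - \<alpha>)"
proof -
  have P: "P \<in> paths_on r G" "w i \<alpha> \<in> verts P" "w i (Suc \<alpha>) \<notin> verts P"
    using assms(1) by (auto simp: left_paths_def)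
  show thesis
    using P(1)
  proof (cases rule: path_cases)
    case (seg i' s)
    have "i = i' \<and> s + r = Suc \<alpha>"
      using mem_seg[OF seg(1-3) assms(2,3), of \<alpha>] mem_seg[OF seg(1-3) assms(2,3), of "Suc \<alpha>"]
        P(2,3) assms seg(4) by auto
    moreover from this have "s = Suc \<alpha> - r"
      by auto
    ultimately show thesis
      using that(1) seg by auto
  next
    case (hub_u i' \<alpha>' j \<beta>)
    have "(i = i' \<and> \<alpha> \<le> \<alpha>') \<or> (i = j \<and> \<alpha> \<le> \<beta>)"
      using mem_hub[OF hub_u(1-4) assms(2,3) _ hub_u(7,9), of \<alpha>] P(2)[unfolded hub_u(11)] assms(4,5)
      by auto
    moreover have "\<not> (i = i' \<and> Suc \<alpha> \<le> \<alpha>')" "\<not> (i = j \<and> Suc \<alpha> \<le> \<beta>)"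
      using mem_hub[OF hub_u(1-4) assms(2,3) _ hub_u(7,9), of "Suc \<alpha>"] P(3)[unfolded hub_u(11)] assms(5)
      by auto
    ultimately have "(i = i' \<and> \<alpha>' = \<alpha>) \<or> (i = j \<and> \<beta> = \<alpha>)"
      by auto
    then show thesis
    proof
      assume "i = i' \<and> \<alpha>' = \<alpha>"
      moreover from this have "\<beta> = r - 1 - \<alpha>"
        using hub_u(10) by simp
      ultimately show thesis
        using that(2)[of j] hub_u by auto
    next
      assume "i = j \<and> \<beta> = \<alpha>"
      moreover from this have "\<alpha>' = r - 1 - \<alpha>"
        using hub_u(10) by simp
      ultimately show thesis
        using that(2)[of i'] hub_u hub_path_swap[of i' j \<alpha>' \<beta>] by auto
    qed
  next
    case (hub_v i' \<gamma> j \<delta>)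
    have False
      using mem_hub_flip[OF hub_v(1-4) assms(2,3) _ hub_v(7,9), of \<alpha>]
        mem_hub_flip[OF hub_v(1-4) assms(2,3) _ hub_v(7,9), of "Suc \<alpha>"]
        P(2,3)[unfolded hub_v(11)] assms(4,5) by auto
    then show thesis ..
  next
    case (bridge i' \<alpha>' j \<beta>)
    have less: "\<alpha>' < a i'" "\<beta> < a j" "1 \<le> i'" "1 \<le> j"
      using bridge a_ge(3)[of i'] a_ge(3)[of j] by auto
    have "i = i' \<and> \<alpha>' = \<alpha>"
      using mem_bridge[OF less(3) bridge(2) less(4) bridge(4) assms(2,3) _ less(1,2), of \<alpha>]
        mem_bridge[OF less(3) bridge(2) less(4) bridge(4) assms(2,3) _ less(1,2), of "Suc \<alpha>"]
        P(2,3)[unfolded bridge(8)] assms(4,5)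
      by auto
    moreover from this have "\<beta> = r - 1 - a 1 - \<alpha>"
      using bridge(7) by simp
    ultimately show thesis
      using that(3)[of j] bridge by auto
  qed
qed

text \<open>One arm on another strand allows \<open>k - 1\<close> choices. If
  \<open>\<alpha> + a 1 + 2 \<le> r\<close>, the first strand is too short for the remaining arm;
  for \<open>i \<noteq> 1\<close> this leaves \<open>k - 2\<close> hub paths and adds
  \<open>k - 1\<close> bridges. Since \<open>\<alpha> \<ge> 1\<close>, that case requires
  \<open>r \<ge> a 1 + 3\<close>.\<close>

lemma card_left_paths:
  assumes "1 \<le> i" "i \<le> k" "1 \<le> \<alpha>" "Suc \<alpha> < a i"
  shows "finite (left_paths i \<alpha>)"
    and "card (left_paths i \<alpha>) \<le> (if r \<le> a 1 + 2 then k - 1 else 2 * k - 3)" (is "_ \<le> ?c")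
proof -
  let ?h = "\<lambda>j. hub_path w i \<alpha> j (r - 1 - \<alpha>)" and ?b = "\<lambda>j. bridge_path a w i \<alpha> j (r - 1 - a 1 - \<alpha>)"
  have "\<exists>S. left_paths i \<alpha> \<subseteq> S \<and> finite S \<and> card S \<le> ?c"
  proof -
    consider "r \<le> Suc \<alpha>" | "Suc \<alpha> < r" "r < \<alpha> + a 1 + 2" | "\<alpha> + a 1 + 2 \<le> r"
      by linarith
    then show ?thesis
    proof cases
      case 1
      have "left_paths i \<alpha> \<subseteq> {seg_path r w i (Suc \<alpha> - r)}"
        using 1 by (auto elim: left_paths_cases[OF _ assms])
      then show ?thesis
        using k3 by (intro exI[of _ "{seg_path r w i (Suc \<alpha> - r)}"]) auto
    next
      case 2
      have "left_paths i \<alpha> \<subseteq> ?h ` ({1..k} - {i})"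
        using 2 by (auto elim: left_paths_cases[OF _ assms])
      moreover have "card (?h ` ({1..k} - {i})) \<le> k - 1"
        using card_image_le[of "{1..k} - {i}" ?h] assms by simp
      ultimately show ?thesis
        using k3 by (intro exI[of _ "?h ` ({1..k} - {i})"]) auto
    next
      case 3
      show ?thesis
      proof (cases "i = 1")
        case True
        have "left_paths i \<alpha> \<subseteq> ?h ` {2..k}"
        proof
          fix P assume "P \<in> left_paths i \<alpha>"
          then show "P \<in> ?h ` {2..k}"
          proof (cases rule: left_paths_cases[OF _ assms, consumes 1, case_names seg hub bridge])
            case (hub j)
            then have "j \<in> {2..k}"
              using True by auto
            then show ?thesis
              using hub(6) by blast
          qed (use 3 True in auto)
        qed
        moreover have "card (?h ` {2..k}) \<le> k - 1"
          using card_image_le[of "{2..k}" ?h] by simp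
        ultimately show ?thesis
          using k3 by (intro exI[of _ "?h ` {2..k}"]) auto
      next
        case False
        have "left_paths i \<alpha> \<subseteq> ?h ` ({2..k} - {i}) \<union> ?b ` {2..k}"
        proof
          fix P assume "P \<in> left_paths i \<alpha>"
          then show "P \<in> ?h ` ({2..k} - {i}) \<union> ?b ` {2..k}"
          proof (cases rule: left_paths_cases[OF _ assms, consumes 1, case_names seg hub bridge])
            case (hub j)
            moreover from this have "j \<noteq> 1"
              using 3 by auto
            ultimately show ?thesis
              by auto
          qed (use 3 in auto)
        qed
        moreover have "card (?h ` ({2..k} - {i}) \<union> ?b ` {2..k}) \<le> (k - 2) + (k - 1)"
          using card_image_le[of "{2..k} - {i}" ?h] card_image_le[of "{2..k}" ?b] assms False
          by (intro order.trans[OF card_Un_le] add_mono) auto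
        moreover have "\<not> r \<le> a 1 + 2"
          using 3 assms by simp
        ultimately show ?thesis
          using k3 by (intro exI[of _ "?h ` ({2..k} - {i}) \<union> ?b ` {2..k}"]) auto
      qed
    qed
  qed
  then obtain S where S: "left_paths i \<alpha> \<subseteq> S" "finite S" "card S \<le> ?c"
    by blast
  show "finite (left_paths i \<alpha>)"
    using S(1,2) by (rule finite_subset)
  show "card (left_paths i \<alpha>) \<le> ?c"
    using card_mono[OF S(2,1)] S(3) by (rule order.trans)
qed

text \<open>
  A path leaving position \<open>\<alpha>\<close> to the left and one leaving \<open>\<alpha> + 1\<close> to the right can only meet by
  closing a cycle of at most \<open>2 * r - 1\<close> vertices. All cycles have at least that length, and since
  \<open>a i > r\<close>, only the cycle of the strands \<open>i\<close> and \<open>1\<close> can attain it.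
\<close>

lemma left_right_meet:
  assumes i: "1 \<le> i" "i \<le> k" "1 \<le> \<alpha>" "Suc \<alpha> < a i" and long: "r < a i"
    and P: "P \<in> left_paths i \<alpha>" and Q: "Q \<in> theta.left_paths w' G r i (a i - Suc \<alpha>)"
    and meet: "verts P \<inter> verts Q \<noteq> {}"
  shows "P = cycle_path i \<alpha>"
proof -
  define \<gamma> where "\<gamma> = a i - Suc \<alpha>"
  have \<gamma>: "1 \<le> \<gamma>" "Suc \<gamma> < a i" "\<gamma> + Suc \<alpha> = a i"
    using i by (auto simp: \<gamma>_def)
  have Q': "Q \<in> theta.left_paths w' G r i \<gamma>"
    using Q by (simp add: \<gamma>_def)
  note Q_cases = theta.left_paths_cases[OF reversed Q' i(1,2) \<gamma>(1,2), case_names seg hub bridge]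
  obtain y where y: "y \<in> verts P" "y \<in> verts Q"
    using meet by blast
  have "P \<in> paths_on r G"
    using P by (simp add: left_paths_def)
  then obtain l n where l: "1 \<le> l" "l \<le> k" "n \<le> a l" "y = w l n"
    using paths_coord y(1) by blast
  have al: "1 \<le> a l"
    using a_ge(1) l by blast
  have seg: "seg_path r w' i (Suc \<gamma> - r) = seg_path r w i (Suc \<alpha>)" if "r \<le> Suc \<gamma>"
  proof -
    have "Suc (a i) - r - (Suc \<gamma> - r) = Suc \<alpha>" "Suc \<gamma> - r + r \<le> Suc (a i)"
      using that \<gamma> by auto
    then show ?thesis
      using seg_flip[of "Suc \<gamma> - r" i] by simp
  qed
  show ?thesis
    using P i
  proof (cases rule: left_paths_cases)
    case seg
    then show ?thesis
      by (simp add: cycle_path_def)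
  next
    case (hub j)
    show ?thesis
    proof (cases "j = 1")
      case True
      then show ?thesis
        using hub by (auto simp: cycle_path_def)
    next
      case False
      then have j: "2 \<le> j" "r \<le> a j"
        using hub a_ge(3)[of j] by auto
      have x: "n = 0 \<or> (l = i \<and> n \<le> \<alpha>) \<or> (l = j \<and> n \<le> r - 1 - \<alpha>)"
        using mem_hub[of i j l n \<alpha> "r - 1 - \<alpha>"] hub i l y(1) j by auto
      from Q_cases show ?thesis
      proof cases
        case seg': seg
        have "(l = i \<and> Suc \<alpha> \<le> n) \<or> n = a l"
          using mem_seg[of i "Suc \<alpha>" l n] seg' seg[OF seg'(1)] \<gamma> i l y(2) by auto
        then show ?thesis
          using x al i j hub by auto
      next
        case hub': (hub j')
        \<comment> \<open>These facts keep \<open>Q\<close> from reaching \<open>u\<close>, which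
          lies on \<open>P\<close>.\<close>
        have "2 \<le> i \<Longrightarrow> r - 1 - \<gamma> \<noteq> a 1"
          using a_sum[of i] i hub(4) \<gamma>(3) a1 by auto
        moreover have "2 \<le> j' \<Longrightarrow> r - 1 - \<gamma> \<noteq> a j'"
          using a_ge(3)[of j'] hub'(2) \<gamma>(1) r3 by auto
        moreover have "i \<noteq> 1 \<or> j' \<noteq> 1"
          using hub'(3) by auto
        ultimately have "r - 1 - \<gamma> < a j'"
          using hub'(1,5) i by (cases "j' = 1"; cases "i = 1") auto
        then have "n = a l \<or> (l = i \<and> a l - n \<le> \<gamma>) \<or> (l = j' \<and> a l - n \<le> r - 1 - \<gamma> \<and> 0 < n)"
          using mem_hub_flip[of i j' l n \<gamma> "r - 1 - \<gamma>"] hub' i l y(2) \<gamma> by auto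
        \<comment> \<open>What remains is \<open>l = j = j'\<close>, where the two arms together
          have \<open>2 * r - 1 - a i < r\<close> edges and cannot cover strand
          \<open>j\<close>.\<close>
        then show ?thesis
          using x al i j hub(3,4) hub'(3,4) \<gamma>(3) long l(3) by auto
      next
        case (bridge j')
        then show ?thesis
          using a_sum[of i] i(2) hub(4) \<gamma>(3) by linarith
      qed
    qed
  next
    case (bridge j)
    show ?thesis
    proof (cases "j = i")
      case True
      then show ?thesis
        using bridge by (auto simp: cycle_path_def)
    next
      case False
      have less: "r - 1 - a 1 - \<alpha> < a j"
        using bridge a_ge(3)[of j] r3 by auto
      have x: "n = 0 \<or> n = a l \<or> l = 1 \<or> (l = i \<and> n \<le> \<alpha>) \<or> l = j"
        using mem_bridge[of i j l n \<alpha> "r - 1 - a 1 - \<alpha>"] bridge i l y(1) less by auto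
      from Q_cases show ?thesis
      proof cases
        case seg': seg
        \<comment> \<open>So \<open>Q\<close> ends before \<open>v\<close>, while \<open>P\<close>,
          because \<open>j \<noteq> i\<close>, meets the interior of strand \<open>i\<close> only up
          to \<open>\<alpha>\<close>.\<close>
        have "Suc \<alpha> + r < Suc (a i)"
          using a_sum[of i] bridge i by auto
        then have "l = i \<and> Suc \<alpha> \<le> n \<and> n < a i"
          using mem_seg[of i "Suc \<alpha>" l n] seg' seg[OF seg'(1)] \<gamma> i l y(2) by auto
        then show ?thesis
          using x False bridge by auto
      next
        case (hub j')
        then show ?thesis
          using a_sum[of i] i(2) bridge(1,4) \<gamma>(3) by linarith
      next
        case bridge': (bridge j')
        then show ?thesis
          using a_sum[of i] i(2) bridge(1,4) \<gamma>(3) by linarith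
      qed
    qed
  qed
qed

text \<open>Counted from \<open>v\<close>, position \<open>Suc \<alpha>\<close> is
  \<open>a i - Suc \<alpha>\<close> and its successor is \<open>\<alpha>\<close>; separation to the
  right is separation to the left in the reversed graph.\<close>

lemma right_paths_iff:
  assumes "Suc \<alpha> \<le> a i"
  shows "theta.left_paths w' G r i (a i - Suc \<alpha>)
    = {P \<in> paths_on r G. w i (Suc \<alpha>) \<in> verts P \<and> w i \<alpha> \<notin> verts P}"
  using assms by (simp add: theta.left_paths_def[OF reversed] flip_def Suc_diff_Suc)

text \<open>If both sides occur, a fixed member of either side meets every member of the other, so
  each side consists of its \<open>cycle_path\<close> alone. The total 2 is at most
  \<open>k - 1\<close>. Otherwise the one-sided count applies.\<close>

lemma card_separating:
  assumes i: "1 \<le> i" "i \<le> k" "1 \<le> \<alpha>" "Suc \<alpha> < a i" and long: "r < a i"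
    and F: "F \<subseteq> paths_on r G" "intersecting F"
  shows "finite {P \<in> F. (w i \<alpha> \<in> verts P) \<noteq> (w i (Suc \<alpha>) \<in> verts P)}" (is "finite ?S")
    and "card {P \<in> F. (w i \<alpha> \<in> verts P) \<noteq> (w i (Suc \<alpha>) \<in> verts P)}
      \<le> (if r \<le> a 1 + 2 then k - 1 else 2 * k - 3)" (is "_ \<le> ?c")
proof -
  define L where "L = F \<inter> left_paths i \<alpha>"
  define R where "R = F \<inter> theta.left_paths w' G r i (a i - Suc \<alpha>)"
  have i': "1 \<le> a i - Suc \<alpha>" "Suc (a i - Suc \<alpha>) < a i"
    using i by auto
  have S: "?S = L \<union> R"
    using F(1) i right_paths_iff[of \<alpha> i] by (auto simp: L_def R_def left_paths_def)
  note left = card_left_paths[OF i] and right = theta.card_left_paths[OF reversed i(1,2) i']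
  have fin: "finite L" "finite R"
    using left(1) right(1) by (auto simp: L_def R_def)
  have le: "card L \<le> ?c" "card R \<le> ?c"
    unfolding L_def R_def
    by (rule order.trans[OF card_mono[OF left(1)] left(2)] order.trans[OF card_mono[OF right(1)] right(2)];
        simp)+
  show "finite ?S"
    unfolding S using fin by simp
  have meet: "verts P \<inter> verts Q \<noteq> {}" if "P \<in> L" "Q \<in> R" for P Q
    using that F(2) by (auto simp: L_def R_def intersecting_def)
  show "card ?S \<le> ?c"
  proof (cases "L = {} \<or> R = {}")
    case True
    then show ?thesis
      unfolding S using le by auto
  next
    case False
    then obtain P0 Q0 where 0: "P0 \<in> L" "Q0 \<in> R"
      by auto
    have "L \<subseteq> {cycle_path i \<alpha>}"
      using left_right_meet[OF i long _ _ meet[OF _ 0(2)]] 0 by (auto simp: L_def R_def)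
    moreover have "R \<subseteq> {theta.cycle_path a w' r i (a i - Suc \<alpha>)}"
    proof
      fix Q assume "Q \<in> R"
      moreover have "P0 \<in> theta.left_paths (flip a w') G r i (a i - Suc (a i - Suc \<alpha>))"
        using 0 i by (simp add: L_def flip_flip)
      moreover have "verts Q \<inter> verts P0 \<noteq> {}"
        using meet[OF 0(1) \<open>Q \<in> R\<close>] by blast
      ultimately show "Q \<in> {theta.cycle_path a w' r i (a i - Suc \<alpha>)}"
        using theta.left_right_meet[OF reversed i(1,2) i' long] by (auto simp: R_def)
    qed
    ultimately have "card ?S \<le> card {cycle_path i \<alpha>, theta.cycle_path a w' r i (a i - Suc \<alpha>)}"
      unfolding S by (intro card_mono) auto
    also have "\<dots> \<le> 2"
      by (simp add: card_insert_if)
    also have "2 \<le> ?c"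
      using k3 by auto
    finally show ?thesis .
  qed
qed

lemma interior_case:
  assumes F: "F \<subseteq> paths_on r G" "intersecting F"
    and A: "A \<in> F" "u \<notin> verts A" "v \<notin> verts A"
  shows "card F < theta_bound k (a 1) r"
proof -
  have "\<exists>i p. 1 \<le> i \<and> i \<le> k \<and> 1 \<le> p \<and> p + r \<le> a i \<and> A = seg_path r w i p"
  proof -
    have "A \<in> paths_on r G"
      using A F by blast
    then show ?thesis
    proof (cases rule: path_cases)
      case (seg i s)
      then have "s \<noteq> 0" "s + r \<noteq> Suc (a i)"
        using mem_seg[of i s i 0] mem_seg[of i s i "a i"] A w_0[of i] w_a[of i] by auto
      with seg show ?thesis
        by (intro exI[of _ i] exI[of _ s]) auto
    next
      case (hub_u i \<alpha> j \<beta>)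
      then show ?thesis
        using mem_hub[of i j i 0 \<alpha> \<beta>] A w_0[of i] by auto
    next
      case (hub_v i \<alpha> j \<beta>)
      then show ?thesis
        using mem_hub_flip[of i j i "a i" \<alpha> \<beta>] A w_a[of i] by auto
    next
      case (bridge i \<alpha> j \<beta>)
      then show ?thesis
        using mem_bridge[of i j i 0 \<alpha> \<beta>] a_ge(3)[of i] a_ge(3)[of j] A w_0[of i] by auto
    qed
  qed
  then obtain i p where i: "1 \<le> i" "i \<le> k" "1 \<le> p" "p + r \<le> a i" and eq: "A = seg_path r w i p"
    by blast
  let ?S = "\<lambda>\<alpha>. {P \<in> F. (w i \<alpha> \<in> verts P) \<noteq> (w i (Suc \<alpha>) \<in> verts P)}"
  let ?c = "if r \<le> a 1 + 2 then k - 1 else 2 * k - 3"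
  have vA: "verts A = w i ` {p..<p + r}"
    by (simp add: eq seg_path_def)
  have "F \<subseteq> insert A (\<Union>\<alpha>\<in>{p..<p + r - 1}. ?S \<alpha>)"
  proof
    fix P assume P: "P \<in> F"
    show "P \<in> insert A (\<Union>\<alpha>\<in>{p..<p + r - 1}. ?S \<alpha>)"
    proof (rule ccontr)
      \<comment> \<open>Without a separated pair, membership in \<open>P\<close> is constant along
        \<open>A\<close>; as \<open>P\<close> meets \<open>A\<close>, it contains all of it.\<close>
      assume no: "P \<notin> insert A (\<Union>\<alpha>\<in>{p..<p + r - 1}. ?S \<alpha>)"
      then have step: "w i \<alpha> \<in> verts P \<longleftrightarrow> w i (Suc \<alpha>) \<in> verts P" if "p \<le> \<alpha>" "\<alpha> < p + r - 1" for \<alpha>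
        using that P by auto
      have all: "w i (p + m) \<in> verts P \<longleftrightarrow> w i p \<in> verts P" if "m < r" for m
        using that
      proof (induction m)
        case (Suc m)
        then show ?case
          using step[of "p + m"] by simp
      qed simp
      have "verts P \<inter> verts A \<noteq> {}"
        using F(2) P A(1) by (auto simp: intersecting_def)
      then obtain n where n: "p \<le> n" "n < p + r" "w i n \<in> verts P"
        by (auto simp: vA)
      then have "w i p \<in> verts P"
        using all[of "n - p"] by simp
      have "w i n \<in> verts P" if "p \<le> n" "n < p + r" for n
        using all[of "n - p"] \<open>w i p \<in> verts P\<close> that by simp
      then have sub: "verts A \<subseteq> verts P"
        by (auto simp: vA)
      have PA: "P \<in> paths_on r G" "A \<in> paths_on r G"
        using P A F by auto
      then have "finite (verts P)" "card (verts P) = card (verts A)"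
        using r3 by (auto simp: paths_on_def intro: card_ge_0_finite)
      then have same: "verts A = verts P"
        using sub by (simp add: card_subset_eq)
      \<comment> \<open>Equal vertex sets alone do not make the paths equal. Avoiding both hubs
        forces \<open>P\<close> to be a segment, and a segment is determined by its
        positions.\<close>
      show False
        using PA(1)
      proof (cases rule: path_cases)
        case (seg i' s)
        have "i = i' \<and> s \<le> p" "p + r - 1 < s + r"
          using mem_seg[OF seg(1-3) i(1,2), of p] mem_seg[OF seg(1-3) i(1,2), of "p + r - 1"]
            \<open>w i p \<in> verts P\<close> all[of "r - 1"] i r3 seg(4) by auto
        then have "s = p" "i = i'"
          by auto
        then have "P = A"
          using seg(4) eq by simp
        then show False
          using no by blast
      next
        case (hub_u i \<alpha> j \<beta>)
        then show False
          using mem_hub[of i j i 0 \<alpha> \<beta>] A w_0[of i] same by auto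
      next
        case (hub_v i \<alpha> j \<beta>)
        then show False
          using mem_hub_flip[of i j i "a i" \<alpha> \<beta>] A w_a[of i] same by auto
      next
        case (bridge i \<alpha> j \<beta>)
        then show False
          using mem_bridge[of i j i 0 \<alpha> \<beta>] a_ge(3)[of i] a_ge(3)[of j] A w_0[of i] same by auto
      qed
    qed
  qed
  \<comment> \<open>The bounds \<open>1 \<le> p\<close> and \<open>p + r \<le> a i\<close> give both
    \<open>Suc \<alpha> < a i\<close> and \<open>r < a i\<close>.\<close>
  moreover have S: "finite (?S \<alpha>)" "card (?S \<alpha>) \<le> ?c" if "\<alpha> \<in> {p..<p + r - 1}" for \<alpha>
    using card_separating[OF i(1,2) _ _ _ F, of \<alpha>] that i r3 by auto
  ultimately have "card F \<le> card (insert A (\<Union>\<alpha>\<in>{p..<p + r - 1}. ?S \<alpha>))"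
    by (intro card_mono) auto
  also have "\<dots> \<le> Suc (card (\<Union>\<alpha>\<in>{p..<p + r - 1}. ?S \<alpha>))"
    by (rule card_insert_le_m1) auto
  also have "\<dots> \<le> Suc (\<Sum>\<alpha>\<in>{p..<p + r - 1}. card (?S \<alpha>))"
    by (simp add: card_UN_le)
  also have "\<dots> \<le> Suc (\<Sum>\<alpha>\<in>{p..<p + r - 1}. ?c)"
    using S(2) by (intro Suc_leI le_imp_less_Suc sum_mono)
  also have "\<dots> = 1 + (r - 1) * ?c"
    by simp
  also have "\<dots> < theta_bound k (a 1) r"
    by (rule interior_bound_less[OF k3 r3])
  finally show ?thesis .
qed

section \<open>Assembly of the bound and the equality case\<close>

lemma intersecting_bound:
  assumes F: "F \<subseteq> paths_on r G" "intersecting F"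
  shows "card F \<le> theta_bound k (a 1) r"
    and "card F = theta_bound k (a 1) r \<longleftrightarrow>
      F = full_star (paths_on r G) u \<or> F = full_star (paths_on r G) v"
proof -
  have card_u: "card (full_star (paths_on r G) u) = theta_bound k (a 1) r"
    and card_v: "card (full_star (paths_on r G) v) = theta_bound k (a 1) r"
    using card_full_star_u theta.card_full_star_u[OF reversed] by auto
  have pos: "0 < theta_bound k (a 1) r"
    using interior_bound_less[OF k3 r3, of "a 1"] by simp
  have *: "card F \<le> theta_bound k (a 1) r \<and> (card F = theta_bound k (a 1) r \<longrightarrow>
      F \<subseteq> full_star (paths_on r G) u \<or> F \<subseteq> full_star (paths_on r G) v)"
  proof (cases "\<forall>P\<in>F. u \<in> verts P \<or> v \<in> verts P")
    case True
    then show ?thesis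
      using hub_case_short[OF F(1) True F(2)] hub_case_long[OF F(1) True F(2)] by (cases "r \<le> a 1") auto
  next
    case False
    then show ?thesis
      using interior_case[OF F] by fastforce
  qed
  then show "card F \<le> theta_bound k (a 1) r" ..
  have "F = full_star (paths_on r G) u \<or> F = full_star (paths_on r G) v"
    if "card F = theta_bound k (a 1) r"
  proof -
    have "finite (full_star (paths_on r G) u)" "finite (full_star (paths_on r G) v)"
      using card_u card_v pos by (metis card_ge_0_finite)+
    then show ?thesis
      using * that card_u card_v card_subset_eq by metis
  qed
  then show "card F = theta_bound k (a 1) r \<longleftrightarrow>
      F = full_star (paths_on r G) u \<or> F = full_star (paths_on r G) v"
    using card_u card_v by blast
qed

end

text \<open>The given parametrisation is arbitrary beyond the ends of the strands; it is replaced by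
  the one that stays constant there, as the locale demands.\<close>

lemma theta_of_generalized_theta:
  assumes "3 \<le> k" "1 \<le> a 1" "mono_on {1..k} a" "generalized_theta k a u v G"
    and "3 \<le> r" "2 * r \<le> a 1 + a 2 + 1"
  obtains w where "theta k a u v w G r"
proof -
  obtain w0 where inj: "\<forall>i\<in>{1..k}. inj_on (w0 i) {0..a i} \<and> w0 i 0 = u \<and> w0 i (a i) = v"
    and disj: "\<forall>i\<in>{1..k}. \<forall>j\<in>{1..k}. i \<noteq> j \<longrightarrow>
      verts (strand a w0 i) \<inter> verts (strand a w0 j) = {u, v}"
    and G: "G = (\<Union>i\<in>{1..k}. verts (strand a w0 i), \<Union>i\<in>{1..k}. edges (strand a w0 i))"
    using assms(4) unfolding generalized_theta_def by blast
  define w where "w i n = w0 i (min n (a i))" for i n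
  have verts: "verts (strand a w0 i) = w i ` {0..a i}" for i
    by (force simp: strand_def w_def simp del: upt_Suc)
  have nth: "map (w0 i) [0..<Suc (a i)] ! n = w i n" if "n \<le> a i" for i n
    using that by (simp add: w_def nth_append del: upt_Suc)
  have edges: "edges (strand a w0 i) = {{w i n, w i (Suc n)} | n. n < a i}" for i
    unfolding strand_def walk_graph_def snd_conv using nth[of _ i]
    by (intro Collect_cong ex_cong1) (auto simp del: upt_Suc)
  have indexed: "(\<Union>i\<in>{1..k}. {f i n | n. n < a i}) = {f i n | i n. 1 \<le> i \<and> i \<le> k \<and> n < a i}"
    for f :: "nat \<Rightarrow> nat \<Rightarrow> 'a set"
    by (auto; blast)
  have "theta k a u v w G r"
  proof
    show "a i \<le> a j" if "1 \<le> i" "i \<le> j" "j \<le> k" for i j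
      using that by (intro mono_onD[OF assms(3)]) auto
    show "inj_on (w i) {0..a i}" if "1 \<le> i" "i \<le> k" for i
      using inj that by (auto simp: inj_on_def w_def)
    show "w i ` {0..a i} \<inter> w j ` {0..a j} = {u, v}"
      if "1 \<le> i" "i \<le> k" "1 \<le> j" "j \<le> k" "i \<noteq> j" for i j
      using disj that by (simp add: verts)
    show "verts G = (\<Union>i\<in>{1..k}. w i ` {0..a i})"
      by (simp add: G verts)
    show "edges G = {{w i n, w i (Suc n)} | i n. 1 \<le> i \<and> i \<le> k \<and> n < a i}"
      unfolding G snd_conv edges by (rule indexed)
  qed (use assms inj in \<open>auto simp: w_def\<close>)
  then show thesis
    by (rule that)
qed

theorem theorem13:
  fixes k r :: nat and a :: "nat \<Rightarrow> nat" and u v :: 'a and \<Theta> :: "'a graph"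
  assumes "k \<ge> 3"
    and "1 \<le> a 1"
    and "mono_on {1..k} a"
    and "a 2 \<ge> 2"
    and "generalized_theta k a u v \<Theta>"
    and "3 \<le> r"
    and "real r \<le> (real (a 1) + real (a 2) + 1) / 2"
  shows "strictly_EKR \<Theta> (paths_on r \<Theta>) \<and>
    (\<forall>F\<subseteq>paths_on r \<Theta>. intersecting F \<longrightarrow>
       card F \<le> theta_bound k (a 1) r \<and>
       (card F = theta_bound k (a 1) r \<longleftrightarrow>
          F = full_star (paths_on r \<Theta>) u \<or> F = full_star (paths_on r \<Theta>) v))"
proof -
  have "real (2 * r) \<le> real (a 1 + a 2 + 1)"
    using assms(7) by simp
  then have "2 * r \<le> a 1 + a 2 + 1"
    by (simp only: of_nat_le_iff)
  then obtain w where "theta k a u v w \<Theta> r"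
    using theta_of_generalized_theta[OF assms(1-3,5,6)] by blast
  then interpret theta k a u v w \<Theta> r .
  have "EKR \<Theta> (paths_on r \<Theta>)"
    unfolding EKR_def
  proof (intro bexI[of _ u] allI impI)
    show "u \<in> verts \<Theta>"
      using w_in_verts[of 1 0] w_0[of 1] k3 by simp
    show "card H \<le> card (full_star (paths_on r \<Theta>) u)"
      if "H \<subseteq> paths_on r \<Theta>" "intersecting H" for H
      unfolding card_full_star_u using that by (rule intersecting_bound(1))
  qed
  moreover have "is_star H" if H: "H \<subseteq> paths_on r \<Theta>" "intersecting H"
    and max: "\<forall>H'\<subseteq>paths_on r \<Theta>. intersecting H' \<longrightarrow> card H' \<le> card H" for H
  proof -
    have "intersecting (full_star (paths_on r \<Theta>) u)"
      by (auto simp: intersecting_def full_star_def)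
    moreover have "full_star (paths_on r \<Theta>) u \<subseteq> paths_on r \<Theta>"
      by (auto simp: full_star_def)
    ultimately have "theta_bound k (a 1) r \<le> card H"
      using max card_full_star_u by metis
    then have "H = full_star (paths_on r \<Theta>) u \<or> H = full_star (paths_on r \<Theta>) v"
      using intersecting_bound[OF H] by simp
    then show ?thesis
      by (auto simp: is_star_def full_star_def)
  qed
  ultimately show ?thesis
    using intersecting_bound unfolding strictly_EKR_def by blast
qed

end
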